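(* Consider the multistage stochastic linear program described in the context, where $\{W_t,\ t=1,\dots,T\}$ is a discrete (finite-state) Markov process, i.e. $\mathbb{P}(\omega_{t+1}\mid\omega_1,\dots,\omega_t)=\mathbb{P}(\omega_{t+1}\mid\omega_t)=\mathbb{P}(\omega_{t+1}\mid I^x_t)$ for $t>0$, and for $t=0$ the law of $\omega_1$ is $\mathbb{P}(\omega_1\mid S_0)=\mathbb{P}(\omega_1\mid I^x_0)$. Run the Quadratic Regularization Method for Markov Models (described in the context) for $k=0,1,2,\dots$ with positive semidefinite matrices $Q_t\succeq0$ and penalty sequence $\{\varrho^k\}$. Suppose that: 1. $\overline{V}^k_T(\cdot,I^x_T)\equiv V^*_T(\cdot,I^x_T)$ for all $I^x_T\in\mathcal{I}^x_T$ and all $k$; 2. dual basic optimal solutions are used in the backward pass; 3. every $\omega\in\Omega$ has strictly positive probability $\mathbb{P}(\omega)>0$; 4. $\varrho^k\ge0$ for all $k$ and $\lim_{k\to\infty}\varrho^k=0$; 5. the feasible sets $\mathcal{X}_t(S_t)$ are bounded for each $t=0,\dots,T$. Then, with probability one, the method converges to an optimal policy of the multistage problem after a finite number of iterations; that is, almost surely there is a finite $k_0$ such that for all $k\ge k_0$ the value function approximations $\overline{V}^k_t$, $t=0,\dots,T$, are optimal in the sense defined in the context: for every $\omega\in\Omega$ and every $t=0,\dots,T$, $$\min_{x_t\in\mathcal{X}_t(S_t(\omega))}\big\{C(S_t(\omega),x_t)+\overline{V}^k_t(R^x_t,I^x_t(\omega))\big\}=\min_{x_t\in\mathcal{X}_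t(S_t(\omega))}\big\{C(S_t(\omega),x_t)+V^*_t(R^x_t,I^x_t(\omega))\big\}.$$
   Context: **Problem.** Let $T\ge 1$ be finite. The data at time $0$, $(A_0,B_0,b_0,c_0)$, are deterministic. For $t=1,\dots,T$ the data $W_t=(A_t,B_t,b_t,c_t)$ (matrices $A_t,B_t$, vectors $b_t,c_t$) are random, with finite set of realizations $\Omega_t$; elements are written $\omega_t\in\Omega_t$, and $A_t(\omega_t)$, etc. denote the corresponding data. A scenario is $\omega=(\omega_1,\dots,\omega_T)\in\Omega\subseteq\Omega_1\times\dots\times\Omega_T$, with probability $\mathbb{P}(\omega)$. The problem is $$\min_{\substack{A_0x_0=b_0,\; x_0\ge0}}\langle c_0,x_0\rangle+\mathbb{E}_1\Big[\min_{\substack{B_0x_0+A_1x_1=b_1,\; x_1\ge0}}\langle c_1,x_1\rangle+\mathbb{E}_2\big[\cdots+\mathbb{E}_T\big[\min_{\substack{B_{T-1}x_{T-1}+A_Tx_T=b_T,\; x_T\ge0}}\langle c_T,x_T\rangle\big]\cdots\big]\Big],$$ where $\mathbb{E}_t$ is the expectation over $W_t$ conditional on the information up to time $t-1$. **Notation.** The post-decision resource state is $R^x_t=B_tx_t$. The post-decision information state $I^x_t=I^x_t(\omega_t)$ is a function of $\omega_t$ (a single deterministic value $I^x_0$ for $t=0$) that determines the conditional law of $\omega_{t+1}$; $\mathcal{I}^x_t$ denotes the finite set of its possible values, and $I^x_t(\omega):=I^x_t(\omega_t)$. The pre-decision state $S_t$ at time $t\ge1$ consists of the previous post-decision resource state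 $R^x_{t-1}$ and the time-$t$ data (the information $I_t(\omega_t)$); $S_0$ is the time-0 data. $C(S_t,x_t)=\langle c_t,x_t\rangle$. The feasible sets are $\mathcal{X}_0(S_0)=\{x_0\ge0:A_0x_0=b_0\}$ and, for $t\ge1$, $\mathcal{X}_t(S_t)=\mathcal{X}_t(R^x_{t-1},I_t(\omega_t))=\{x_t\ge0:R^x_{t-1}+A_t(\omega_t)x_t=b_t(\omega_t)\}$. Inside any minimization over $x_t$, $R^x_t$ stands for $B_tx_t$. **Standing assumption (relatively complete recourse).** The time-$0$ problem is feasible, and for every sequence of feasible decisions up to time $t<T$ and every $\omega_{t+1}\in\Omega_{t+1}$ the resulting set $\mathcal{X}_{t+1}(S_{t+1})$ is nonempty. **Optimal value functions.** $V^*_T\equiv0$ and, for $t=T,\dots,1$ and $I^x_{t-1}\in\mathcal{I}^x_{t-1}$, $V^*_{t-1}(R^x_{t-1},I^x_{t-1})=\sum_{\omega_t\in\Omega_t}\mathbb{P}(\omega_t\mid I^x_{t-1})\min_{x_t\in\mathcal{X}_t(R^x_{t-1},I_t(\omega_t))}\{C(S_t(\omega_t),x_t)+V^*_t(R^x_t,I^x_t(\omega_t))\}$. **The method.** Fix $Q_t\succeq0$, $t=0,\dots,T$, and $\{\varrho^k\}$. Set $\overline{V}^k_T:=V^*_T$ for all $k$, and $\overline{V}^{-1}_t(\cdot,I^x_t):=-\infty$ for $t<T$ and all $I^x_t\in\mathcal{I}^x_t$. For $k=0,1,2,\dots$: *Forward pass.* Sample $\omega\in\Omega$ according to the law $\mathbb{P}$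 of the Markov process, independently of all previous iterations. For $t=0,\dots,T$, with $S_t(\omega)$ determined by $R^{x,k}_{t-1}$ (for $t\ge 1$) and the data $\omega_t$, select $x^k_t$ as follows. If $k=0$: $x_t^k\in\arg\min_{x_t\in\mathcal{X}_t(S_t(\omega))}C(S_t(\omega),x_t)$. If $k\ge1$ and $t<T$: $$x^k_t\in\arg\min_{x_t\in\mathcal{X}_t(S_t(\omega))}\Big\{C(S_t(\omega),x_t)+\overline{V}^{k-1}_t(R^x_t,I^x_t(\omega))+\tfrac{\varrho^k}{2}\big\langle R^x_t-\overline{R}^{x,k-1}_t,\,Q_t(R^x_t-\overline{R}^{x,k-1}_t)\big\rangle\Big\}.$$ If $k\ge1$ and $t=T$: $x^k_T\in\arg\min_{x_T\in\mathcal{X}_T(S_T(\omega))}\{C(S_T(\omega),x_T)+\overline{V}^{k-1}_T(R^x_T,I^x_T(\omega))\}$. Then set $R^{x,k}_t=B_tx^k_t$ (with the realized $B_t$). The selected minimizer is a function of the outcome of the previous iterations and of $\omega_1,\dots,\omega_t$ only. *Backward pass.* For $t=T,\dots,1$: for each $\omega_t\in\Omega_t$ let $\underline{V}^k_t(R^x_{t-1},\omega_t)=\min_{x_t\in\mathcal{X}_t(R^x_{t-1},I_t(\omega_t))}\{C(S_t(\omega_t),x_t)+\overline{V}^k_t(R^x_t,I^x_t(\omega_t))\}$ and choose a subgradient $\underline{\beta}^k_t(\omega_t)\in\partial_{R^x_{t-1}}\underline{V}^k_t(R^{x,k}_{t-1},\omega_t)$. For every $I=I^x_{t-1}\in\mathcal{I}^x_{t-1}$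 set $\alpha^k_{t-1}(I)=\sum_{\omega_t}\mathbb{P}(\omega_t\mid I)\underline{V}^k_t(R^{x,k}_{t-1},\omega_t)$, $\beta^k_{t-1}(I)=\sum_{\omega_t}\mathbb{P}(\omega_t\mid I)\underline{\beta}^k_t(\omega_t)$, $h^k_{t-1}(R,I)=\alpha^k_{t-1}(I)+\langle\beta^k_{t-1}(I),R-R^{x,k}_{t-1}\rangle$, and $\overline{V}^k_{t-1}(R,I)=\max\{\overline{V}^{k-1}_{t-1}(R,I),h^k_{t-1}(R,I)\}$. *Incumbents.* Set $\overline{R}^{x,k}_t=R^{x,k}_t$ for $t=0,\dots,T-1$. **Dual basic solutions.** The problem defining $\underline{V}^k_t(R^{x,k}_{t-1},\omega_t)$ is a linear program: minimize $\langle c_t,x_t\rangle+\theta$ subject to $A_tx_t=b_t-R^{x,k}_{t-1}$, $x_t\ge0$, and $\theta\ge h^j_t(B_tx_t,I^x_t(\omega_t))$ for $j\le k$ (for $t=T$, no $\theta$ and no cuts). "Dual basic optimal solutions are used" means that each $\underline{\beta}^k_t(\omega_t)$ equals $-\pi$, where $\pi$ is the vector of multipliers of the equality constraints in a basic optimal solution of the dual of this linear program. **Optimality of approximations.** The approximations $\overline{V}^k_t$, $t=0,\dots,T$, are optimal if for every $\omega\in\Omega$ and $t=0,\dots,T$ the equality displayed in the claim holds, where $S_t(\omega)$ is the state reached at time $t$ along $\omega$ by the forward-pass decisions of the method computed with the approximations $\overline{V}^k$ (i.e. the states that the forward pass of iteration $k+1$ generates if $\omega$ is the sampled scenario). *)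

theory Defs
  imports "HOL-Probability.Probability" "Jordan_Normal_Form.Matrix"
begin

unbundle no inner_syntax
unbundle no vec_syntax

text \<open>
  Data of a multistage stochastic linear program. A scenario is an extensional function on
  \<open>{0..horizon}\<close>; the deterministic stage 0 is encoded by a one-element set of realizations.
  \<open>nvar t\<close> is the dimension of \<open>x\<^sub>t\<close>, \<open>nrow t\<close> the number of rows of \<open>A\<^sub>t\<close>, so that \<open>B\<^sub>t\<close> has
  \<open>nrow (t + 1)\<close> rows. \<open>info t w\<close> is the post-decision information state \<open>I\<^sup>x\<^sub>t(\<omega>\<^sub>t)\<close>.
\<close>

record ('w, 'i) mslp =
  horizon :: nat
  nvar :: "nat \<Rightarrow> nat"
  nrow :: "nat \<Rightarrow> nat"
  realizations :: "nat \<Rightarrow> 'w set"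
  scenarios :: "(nat \<Rightarrow> 'w) set"
  law :: "(nat \<Rightarrow> 'w) pmf"
  matA :: "nat \<Rightarrow> 'w \<Rightarrow> real mat"
  matB :: "nat \<Rightarrow> 'w \<Rightarrow> real mat"
  rhs :: "nat \<Rightarrow> 'w \<Rightarrow> real vec"
  cost :: "nat \<Rightarrow> 'w \<Rightarrow> real vec"
  info :: "nat \<Rightarrow> 'w \<Rightarrow> 'i"

definition mslp_data :: "('w, 'i) mslp \<Rightarrow> bool" where
  "mslp_data P \<longleftrightarrow>
     1 \<le> horizon P \<and>
     (\<forall>t\<le>horizon P. finite (realizations P t)) \<and>
     card (realizations P 0) = 1 \<and>
     scenarios P \<subseteq> (\<Pi>\<^sub>E t\<in>{0..horizon P}. realizations P t) \<and>
     set_pmf (law P) \<subseteq> scenarios P \<and>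
     (\<forall>t\<le>horizon P. \<forall>w\<in>realizations P t.
        matA P t w \<in> carrier_mat (nrow P t) (nvar P t) \<and>
        matB P t w \<in> carrier_mat (nrow P (Suc t)) (nvar P t) \<and>
        rhs P t w \<in> carrier_vec (nrow P t) \<and>
        cost P t w \<in> carrier_vec (nvar P t))"

definition info_states :: "('w, 'i) mslp \<Rightarrow> nat \<Rightarrow> 'i set" where
  "info_states P t = info P t ` realizations P t"

text \<open>\<open>trans_prob P t i w\<close> is \<open>\<P>(\<omega>\<^sub>t\<^sub>+\<^sub>1 = w | I\<^sup>x\<^sub>t = i)\<close>.\<close>

definition trans_prob :: "('w, 'i) mslp \<Rightarrow> nat \<Rightarrow> 'i \<Rightarrow> 'w \<Rightarrow> real" where
  "trans_prob P t i w =
     \<P>(\<omega> in measure_pmf (law P). \<omega> (Suc t) = w \<bar> info P t (\<omega> t) = i)"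

definition markov_process :: "('w, 'i) mslp \<Rightarrow> bool" where
  "markov_process P \<longleftrightarrow>
     (\<forall>t<horizon P. \<forall>\<omega>\<in>scenarios P. \<forall>w\<in>realizations P (Suc t).
        \<P>(\<omega>' in measure_pmf (law P). \<omega>' (Suc t) = w \<bar> (\<forall>s\<le>t. \<omega>' s = \<omega> s)) =
        \<P>(\<omega>' in measure_pmf (law P). \<omega>' (Suc t) = w \<bar> \<omega>' t = \<omega> t) \<and>
        \<P>(\<omega>' in measure_pmf (law P). \<omega>' (Suc t) = w \<bar> \<omega>' t = \<omega> t) =
        trans_prob P t (info P t (\<omega> t)) w)"

text \<open>At stage 0 there is no incoming resource; \<open>feasible\<close> is then used with \<open>R = 0\<close>.\<close>

definition feasible :: "('w, 'i) mslp \<Rightarrow> nat \<Rightarrow> real vec \<Rightarrow> 'w \<Rightarrow> real vec set" where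
  "feasible P t R w =
     {x \<in> carrier_vec (nvar P t). 0\<^sub>v (nvar P t) \<le> x \<and> R + matA P t w *\<^sub>v x = rhs P t w}"

definition incoming :: "('w, 'i) mslp \<Rightarrow> (nat \<Rightarrow> 'w) \<Rightarrow> (nat \<Rightarrow> real vec) \<Rightarrow> nat \<Rightarrow> real vec" where
  "incoming P \<omega> x t =
     (case t of 0 \<Rightarrow> 0\<^sub>v (nrow P 0) | Suc s \<Rightarrow> matB P s (\<omega> s) *\<^sub>v x s)"

definition relatively_complete_recourse :: "('w, 'i) mslp \<Rightarrow> bool" where
  "relatively_complete_recourse P \<longleftrightarrow>
     (\<forall>w\<in>realizations P 0. feasible P 0 (0\<^sub>v (nrow P 0)) w \<noteq> {}) \<and>
     (\<forall>\<omega>\<in>scenarios P. \<forall>x. \<forall>t<horizon P.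
        (\<forall>s\<le>t. x s \<in> feasible P s (incoming P \<omega> x s) (\<omega> s)) \<longrightarrow>
        (\<forall>w\<in>realizations P (Suc t). feasible P (Suc t) (incoming P \<omega> x (Suc t)) w \<noteq> {}))"

definition bounded_vecs :: "real vec set \<Rightarrow> bool" where
  "bounded_vecs X \<longleftrightarrow> (\<exists>K. \<forall>x\<in>X. \<forall>i<dim_vec x. \<bar>x $ i\<bar> \<le> K)"

definition bounded_feasible_sets :: "('w, 'i) mslp \<Rightarrow> bool" where
  "bounded_feasible_sets P \<longleftrightarrow>
     (\<forall>w\<in>realizations P 0. bounded_vecs (feasible P 0 (0\<^sub>v (nrow P 0)) w)) \<and>
     (\<forall>t\<in>{1..horizon P}. \<forall>w\<in>realizations P t. \<forall>R\<in>carrier_vec (nrow P t).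
        bounded_vecs (feasible P t R w))"

definition psd :: "nat \<Rightarrow> real mat \<Rightarrow> bool" where
  "psd n Q \<longleftrightarrow> Q \<in> carrier_mat n n \<and> transpose_mat Q = Q \<and>
     (\<forall>v\<in>carrier_vec n. 0 \<le> v \<bullet> (Q *\<^sub>v v))"

text \<open>
  Values are extended reals: minimizing over an empty set gives \<open>\<infinity>\<close>. In \<open>stage_value P W t R w\<close>,
  \<open>W\<close> is the (exact or approximate) value function of the post-decision state at time \<open>t\<close>.
\<close>

definition stage_value ::
    "('w, 'i) mslp \<Rightarrow> (real vec \<Rightarrow> 'i \<Rightarrow> ereal) \<Rightarrow> nat \<Rightarrow> real vec \<Rightarrow> 'w \<Rightarrow> ereal" where
  "stage_value P W t R w =
     (INF x\<in>feasible P t R w. ereal (cost P t w \<bullet> x) + W (matB P t w *\<^sub>v x) (info P t w))"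

definition expected_stage_value ::
    "('w, 'i) mslp \<Rightarrow> (real vec \<Rightarrow> 'i \<Rightarrow> ereal) \<Rightarrow> nat \<Rightarrow> real vec \<Rightarrow> 'i \<Rightarrow> ereal" where
  "expected_stage_value P W t R i =
     (\<Sum>w\<in>realizations P (Suc t). ereal (trans_prob P t i w) * stage_value P W (Suc t) R w)"

function Vstar :: "('w, 'i) mslp \<Rightarrow> nat \<Rightarrow> real vec \<Rightarrow> 'i \<Rightarrow> ereal" where
  "Vstar P t =
     (if horizon P \<le> t then (\<lambda>R i. 0) else expected_stage_value P (Vstar P (Suc t)) t)"
  by auto
termination
  by (relation "measures [\<lambda>(P, t). horizon P - t]") auto

declare Vstar.simps [simp del]

text \<open>
  Below, \<open>Rs k t\<close> is the trial point \<open>R\<^sup>x\<^sup>,\<^sup>k\<^sub>t\<close> and \<open>g k t w\<close> the subgradient chosen in iteration \<open>k\<close>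
  at stage \<open>t\<close> for the realization \<open>w\<close>.
\<close>

definition cut_slope :: "('w, 'i) mslp \<Rightarrow> ('w \<Rightarrow> real vec) \<Rightarrow> nat \<Rightarrow> 'i \<Rightarrow> real vec" where
  "cut_slope P h t i =
     vec (nrow P (Suc t)) (\<lambda>r. \<Sum>w\<in>realizations P (Suc t). trans_prob P t i w * (h w $ r))"

definition cut ::
    "('w, 'i) mslp \<Rightarrow> (real vec \<Rightarrow> 'i \<Rightarrow> ereal) \<Rightarrow> real vec \<Rightarrow> ('w \<Rightarrow> real vec) \<Rightarrow> nat \<Rightarrow>
      real vec \<Rightarrow> 'i \<Rightarrow> ereal" where
  "cut P W Rhat h t R i =
     expected_stage_value P W t Rhat i + ereal (cut_slope P h t i \<bullet> (R - Rhat))"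

text \<open>For \<open>k = 0\<close> the maximum with the initial approximation \<open>-\<infinity>\<close> is the cut itself.\<close>

function Vbar ::
    "('w, 'i) mslp \<Rightarrow> (nat \<Rightarrow> nat \<Rightarrow> real vec) \<Rightarrow> (nat \<Rightarrow> nat \<Rightarrow> 'w \<Rightarrow> real vec) \<Rightarrow> nat \<Rightarrow> nat \<Rightarrow>
      real vec \<Rightarrow> 'i \<Rightarrow> ereal" where
  "Vbar P Rs g k t =
     (if horizon P \<le> t then Vstar P t
      else case k of
        0 \<Rightarrow> cut P (Vbar P Rs g k (Suc t)) (Rs k t) (g k (Suc t)) t
      | Suc j \<Rightarrow> (\<lambda>R i. max (Vbar P Rs g j t R i)
                   (cut P (Vbar P Rs g k (Suc t)) (Rs k t) (g k (Suc t)) t R i)))"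
  by auto
termination
  by (relation "measures [\<lambda>(P, Rs, g, k, t). horizon P - t, \<lambda>(P, Rs, g, k, t). k]") auto

declare Vbar.simps [simp del]

definition subdifferential :: "nat \<Rightarrow> (real vec \<Rightarrow> ereal) \<Rightarrow> real vec \<Rightarrow> real vec set" where
  "subdifferential n f R0 =
     {d \<in> carrier_vec n. \<bar>f R0\<bar> \<noteq> \<infinity> \<and>
        (\<forall>R\<in>carrier_vec n. f R0 + ereal (d \<bullet> (R - R0)) \<le> f R)}"

text \<open>
  The columns of \<open>G\<close> and the entries of \<open>a\<close> are the slopes and intercepts of the cuts, and
  \<open>q = b - R\<close>. The dual of: minimize \<open>\<langle>c, x\<rangle> + \<theta>\<close> subject to \<open>A x = q\<close>, \<open>x \<ge> 0\<close>,
  \<open>\<theta> \<ge> a\<^sub>j + \<langle>G\<^sub>j, B x\<rangle>\<close> has, with slacks \<open>s\<close>, the equality form: maximize \<open>\<langle>q, \<pi>\<rangle> + \<langle>a, \<mu>\<rangle>\<close> subject to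
  \<open>A\<^sup>T \<pi> - B\<^sup>T G \<mu> + s = c\<close>, \<open>\<Sum>\<^sub>j \<mu>\<^sub>j = 1\<close>, \<open>\<mu> \<ge> 0\<close>, \<open>s \<ge> 0\<close>, with \<open>\<pi>\<close> free.
  Without cuts there is no \<open>\<theta>\<close> and hence no normalization of \<open>\<mu>\<close>.
\<close>

definition dual_lhs ::
    "real mat \<Rightarrow> real mat \<Rightarrow> real mat \<Rightarrow> real vec \<times> real vec \<times> real vec \<Rightarrow> real vec" where
  "dual_lhs A B G = (\<lambda>(\<pi>, \<mu>, s).
     transpose_mat A *\<^sub>v \<pi> - transpose_mat B *\<^sub>v (G *\<^sub>v \<mu>) + s)"

definition dual_space :: "real mat \<Rightarrow> real mat \<Rightarrow> (real vec \<times> real vec \<times> real vec) set" where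
  "dual_space A G =
     carrier_vec (dim_row A) \<times> carrier_vec (dim_col G) \<times> carrier_vec (dim_col A)"

definition dual_feasible ::
    "real mat \<Rightarrow> real mat \<Rightarrow> real mat \<Rightarrow> real vec \<Rightarrow> real vec \<times> real vec \<times> real vec \<Rightarrow> bool" where
  "dual_feasible A B G c = (\<lambda>(\<pi>, \<mu>, s).
     (\<pi>, \<mu>, s) \<in> dual_space A G \<and>
     dual_lhs A B G (\<pi>, \<mu>, s) = c \<and>
     (0 < dim_col G \<longrightarrow> (\<Sum>j<dim_col G. \<mu> $ j) = 1) \<and>
     0\<^sub>v (dim_col G) \<le> \<mu> \<and> 0\<^sub>v (dim_col A) \<le> s)"

text \<open>
  Basic: the columns of the equality system that belong to the nonzero variables are linearly
  independent.
\<close>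

definition dual_basic ::
    "real mat \<Rightarrow> real mat \<Rightarrow> real mat \<Rightarrow> real vec \<times> real vec \<times> real vec \<Rightarrow> bool" where
  "dual_basic A B G = (\<lambda>(\<pi>, \<mu>, s).
     \<forall>(\<pi>', \<mu>', s')\<in>dual_space A G.
       (\<forall>i<dim_row A. \<pi> $ i = 0 \<longrightarrow> \<pi>' $ i = 0) \<and>
       (\<forall>j<dim_col G. \<mu> $ j = 0 \<longrightarrow> \<mu>' $ j = 0) \<and>
       (\<forall>l<dim_col A. s $ l = 0 \<longrightarrow> s' $ l = 0) \<and>
       dual_lhs A B G (\<pi>', \<mu>', s') = 0\<^sub>v (dim_col A) \<and>
       (\<Sum>j<dim_col G. \<mu>' $ j) = 0 \<longrightarrow>
       \<pi>' = 0\<^sub>v (dim_row A) \<and> \<mu>' = 0\<^sub>v (dim_col G) \<and> s' = 0\<^sub>v (dim_col A))"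

definition dual_basic_optimal ::
    "real mat \<Rightarrow> real mat \<Rightarrow> real mat \<Rightarrow> real vec \<Rightarrow> real vec \<Rightarrow> real vec \<Rightarrow>
      real vec \<times> real vec \<times> real vec \<Rightarrow> bool" where
  "dual_basic_optimal A B G c q a y \<longleftrightarrow>
     is_arg_max (\<lambda>(\<pi>, \<mu>, s). q \<bullet> \<pi> + a \<bullet> \<mu>) (dual_feasible A B G c) y \<and> dual_basic A B G y"

definition cut_slopes ::
    "('w, 'i) mslp \<Rightarrow> (nat \<Rightarrow> nat \<Rightarrow> 'w \<Rightarrow> real vec) \<Rightarrow> nat \<Rightarrow> nat \<Rightarrow> 'i \<Rightarrow> real mat" where
  "cut_slopes P g k t i =
     mat_of_cols (nrow P (Suc t))
       (if t < horizon P then map (\<lambda>j. cut_slope P (g j (Suc t)) t i) [0..<Suc k] else [])"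

definition cut_intercepts ::
    "('w, 'i) mslp \<Rightarrow> (nat \<Rightarrow> nat \<Rightarrow> real vec) \<Rightarrow> (nat \<Rightarrow> nat \<Rightarrow> 'w \<Rightarrow> real vec) \<Rightarrow> nat \<Rightarrow> nat \<Rightarrow> 'i \<Rightarrow>
      real vec" where
  "cut_intercepts P Rs g k t i =
     vec_of_list
       (if t < horizon P then
          map (\<lambda>j. real_of_ereal (expected_stage_value P (Vbar P Rs g j (Suc t)) t (Rs j t) i)
                     - cut_slope P (g j (Suc t)) t i \<bullet> Rs j t) [0..<Suc k]
        else [])"

text \<open>
  A path of the algorithm is given by the sampled scenarios \<open>\<xi> k\<close> and the chosen subgradients
  \<open>g k\<close>. The rule \<open>sel\<close> selecting the forward-pass minimizers receives the outcome of the previous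
  iterations, the stage \<open>t\<close> and the scenario up to stage \<open>t\<close>; together with \<open>sel\<close>, the pairs
  \<open>(\<xi> j, g j)\<close> for \<open>j < k\<close> determine everything computed before iteration \<open>k\<close>.
  \<open>decision sel \<xi> g k \<omega> t\<close> is the decision of iteration \<open>k\<close> at stage \<open>t\<close> if \<open>\<omega>\<close> is sampled.
\<close>

type_synonym 'w outcome = "(nat \<Rightarrow> 'w) \<times> (nat \<Rightarrow> 'w \<Rightarrow> real vec)"

type_synonym 'w selection = "'w outcome list \<Rightarrow> nat \<Rightarrow> (nat \<Rightarrow> 'w) \<Rightarrow> real vec"

definition history ::
    "(nat \<Rightarrow> nat \<Rightarrow> 'w) \<Rightarrow> (nat \<Rightarrow> nat \<Rightarrow> 'w \<Rightarrow> real vec) \<Rightarrow> nat \<Rightarrow> 'w outcome list" where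
  "history \<xi> g k = map (\<lambda>j. (\<xi> j, g j)) [0..<k]"

definition decision ::
    "'w selection \<Rightarrow> (nat \<Rightarrow> nat \<Rightarrow> 'w) \<Rightarrow> (nat \<Rightarrow> nat \<Rightarrow> 'w \<Rightarrow> real vec) \<Rightarrow> nat \<Rightarrow> (nat \<Rightarrow> 'w) \<Rightarrow>
      nat \<Rightarrow> real vec" where
  "decision sel \<xi> g k \<omega> t = sel (history \<xi> g k) t (restrict \<omega> {0..t})"

definition trial ::
    "('w, 'i) mslp \<Rightarrow> 'w selection \<Rightarrow> (nat \<Rightarrow> nat \<Rightarrow> 'w) \<Rightarrow> (nat \<Rightarrow> nat \<Rightarrow> 'w \<Rightarrow> real vec) \<Rightarrow>
      nat \<Rightarrow> nat \<Rightarrow> real vec" where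
  "trial P sel \<xi> g k t = matB P t (\<xi> k t) *\<^sub>v decision sel \<xi> g k (\<xi> k) t"

definition approx ::
    "('w, 'i) mslp \<Rightarrow> 'w selection \<Rightarrow> (nat \<Rightarrow> nat \<Rightarrow> 'w) \<Rightarrow> (nat \<Rightarrow> nat \<Rightarrow> 'w \<Rightarrow> real vec) \<Rightarrow>
      nat \<Rightarrow> nat \<Rightarrow> real vec \<Rightarrow> 'i \<Rightarrow> ereal" where
  "approx P sel \<xi> g k t = Vbar P (trial P sel \<xi> g) g k t"

definition forward_objective ::
    "('w, 'i) mslp \<Rightarrow> (nat \<Rightarrow> real mat) \<Rightarrow> (nat \<Rightarrow> real) \<Rightarrow> 'w selection \<Rightarrow> (nat \<Rightarrow> nat \<Rightarrow> 'w) \<Rightarrow>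
      (nat \<Rightarrow> nat \<Rightarrow> 'w \<Rightarrow> real vec) \<Rightarrow> nat \<Rightarrow> nat \<Rightarrow> 'w \<Rightarrow> real vec \<Rightarrow> ereal" where
  "forward_objective P Q \<rho> sel \<xi> g k t w x =
     (let R = matB P t w *\<^sub>v x in
      case k of
        0 \<Rightarrow> ereal (cost P t w \<bullet> x)
      | Suc j \<Rightarrow> ereal (cost P t w \<bullet> x) + approx P sel \<xi> g j t R (info P t w) +
          (if t < horizon P then
             ereal (\<rho> k / 2 * ((R - trial P sel \<xi> g j t) \<bullet> (Q t *\<^sub>v (R - trial P sel \<xi> g j t))))
           else 0))"

definition forward_passes ::
    "('w, 'i) mslp \<Rightarrow> (nat \<Rightarrow> real mat) \<Rightarrow> (nat \<Rightarrow> real) \<Rightarrow> 'w selection \<Rightarrow> (nat \<Rightarrow> nat \<Rightarrow> 'w) \<Rightarrow>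
      (nat \<Rightarrow> nat \<Rightarrow> 'w \<Rightarrow> real vec) \<Rightarrow> bool" where
  "forward_passes P Q \<rho> sel \<xi> g \<longleftrightarrow>
     (\<forall>k. \<xi> k \<in> scenarios P) \<and>
     (\<forall>k. \<forall>\<omega>\<in>scenarios P. \<forall>t\<le>horizon P.
        is_arg_min (forward_objective P Q \<rho> sel \<xi> g k t (\<omega> t))
          (\<lambda>x. x \<in> feasible P t (incoming P \<omega> (decision sel \<xi> g k \<omega>) t) (\<omega> t))
          (decision sel \<xi> g k \<omega> t))"

definition backward_passes ::
    "('w, 'i) mslp \<Rightarrow> 'w selection \<Rightarrow> (nat \<Rightarrow> nat \<Rightarrow> 'w) \<Rightarrow> (nat \<Rightarrow> nat \<Rightarrow> 'w \<Rightarrow> real vec) \<Rightarrow> bool" where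
  "backward_passes P sel \<xi> g \<longleftrightarrow>
     (\<forall>k. \<forall>t\<in>{1..horizon P}. \<forall>w\<in>realizations P t.
        g k t w \<in> subdifferential (nrow P t)
          (\<lambda>R. stage_value P (approx P sel \<xi> g k t) t R w) (trial P sel \<xi> g k (t - 1)))"

definition dual_basic_solutions_used ::
    "('w, 'i) mslp \<Rightarrow> 'w selection \<Rightarrow> (nat \<Rightarrow> nat \<Rightarrow> 'w) \<Rightarrow> (nat \<Rightarrow> nat \<Rightarrow> 'w \<Rightarrow> real vec) \<Rightarrow> bool" where
  "dual_basic_solutions_used P sel \<xi> g \<longleftrightarrow>
     (\<forall>k. \<forall>t\<in>{1..horizon P}. \<forall>w\<in>realizations P t.
        \<exists>\<pi> \<mu> s. dual_basic_optimal (matA P t w) (matB P t w)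
                   (cut_slopes P g k t (info P t w)) (cost P t w)
                   (rhs P t w - trial P sel \<xi> g k (t - 1))
                   (cut_intercepts P (trial P sel \<xi> g) g k t (info P t w)) (\<pi>, \<mu>, s) \<and>
                 g k t w = - \<pi>)"

text \<open>
  The random path lives on a probability space \<open>M\<close>; besides the samples, the choice of the
  subgradients may be random. \<open>indep_set\<close> includes measurability of both arguments.
\<close>

definition independent_sampling ::
    "('w, 'i) mslp \<Rightarrow> 'z measure \<Rightarrow> ('z \<Rightarrow> nat \<Rightarrow> nat \<Rightarrow> 'w) \<Rightarrow>
      ('z \<Rightarrow> nat \<Rightarrow> nat \<Rightarrow> 'w \<Rightarrow> real vec) \<Rightarrow> bool" where
  "independent_sampling P M \<xi> g \<longleftrightarrow>
     prob_space M \<and>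
     (\<forall>k. distr M (count_space UNIV) (\<lambda>z. \<xi> z k) = measure_pmf (law P) \<and>
          prob_space.indep_set M
            (sets (vimage_algebra (space M) (\<lambda>z. history (\<xi> z) (g z) k) (count_space UNIV)))
            (sets (vimage_algebra (space M) (\<lambda>z. \<xi> z k) (count_space UNIV))))"

text \<open>The states at which the approximations of iteration \<open>k\<close> are tested are those generated by the
  forward pass of iteration \<open>k + 1\<close>.\<close>

definition approximations_optimal ::
    "('w, 'i) mslp \<Rightarrow> 'w selection \<Rightarrow> (nat \<Rightarrow> nat \<Rightarrow> 'w) \<Rightarrow> (nat \<Rightarrow> nat \<Rightarrow> 'w \<Rightarrow> real vec) \<Rightarrow>
      nat \<Rightarrow> bool" where
  "approximations_optimal P sel \<xi> g k \<longleftrightarrow>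
     (\<forall>\<omega>\<in>scenarios P. \<forall>t\<le>horizon P.
        (let R = incoming P \<omega> (decision sel \<xi> g (Suc k) \<omega>) t in
         stage_value P (approx P sel \<xi> g k t) t R (\<omega> t) =
         stage_value P (Vstar P t) t R (\<omega> t)))"

end

theory Submission
  imports Defs
begin

text \<open>
  In a basic dual solution only distinct cut slopes can carry weight, so by backward induction over the
  stages only finitely many slopes ever occur. Since the constant term of a cut is determined by its slope
  and by the function it supports, only finitely many cuts occur, and along every path of the method the
  approximations become constant after finitely many iterations. For a piecewise linear objective and a
  sufficiently small penalty the regularized minimizers are exact minimizers, uniformly in the state,
  because descent directions can be chosen from a finite set. Hence, if the Bellman equation holds at all
  states reached from the approximations of a late iteration, these approximations are optimal. If it fails
  along some scenario, then that scenario is sampled next with a probability bounded away from zero, and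
  sampling it changes the approximations; almost surely this happens only finitely often.
\<close>

subsection \<open>Basic solutions of the dual problem\<close>

text \<open>Stabilization of the approximations alone is not enough. The limit may be wrong away
  from the trial points, and the forward decisions need not settle, because penalty and incumbent
  still change from one iteration to the next, so the states at which optimality is tested keep
  moving. Two uniformities answer this. The exactness threshold must not depend on the incoming
  state or on the incumbent, which is why a common bound is proved for all decisions of all
  iterations along all scenarios. And the Bellman equation is tested along every scenario with the
  decisions that the next iteration would take if that scenario were drawn; such a test involves
  past outcomes only and is therefore independent of the next sample, however minimizers and
  subgradients are chosen. The stabilization time and the exactness threshold may depend on the
  path, so they are used path by path; probability enters only in showing that a gap cannot recur
  forever without being sampled.\<close>

lemma mult_mat_vec_index_sum:
  assumes "r < dim_row G" "dim_vec v = dim_col G"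
  shows "(G *\<^sub>v v) $ r = (\<Sum>j<dim_col G. col G j $ r * v $ j)"
  using assms by (auto simp: scalar_prod_def lessThan_atLeast0 intro!: sum.cong)

lemma dual_lhs_diff:
  assumes "A \<in> carrier_mat m n" "B \<in> carrier_mat p n" "G \<in> carrier_mat p k"
    and "\<pi> \<in> carrier_vec m" "\<mu> \<in> carrier_vec k" "s \<in> carrier_vec n"
    and "\<pi>' \<in> carrier_vec m" "\<mu>' \<in> carrier_vec k" "s' \<in> carrier_vec n"
  shows "dual_lhs A B G (\<pi> - \<pi>', \<mu> - \<mu>', s - s') = dual_lhs A B G (\<pi>, \<mu>, s) - dual_lhs A B G (\<pi>', \<mu>', s')"
proof -
  have "transpose_mat A *\<^sub>v (\<pi> - \<pi>') = transpose_mat A *\<^sub>v \<pi> - transpose_mat A *\<^sub>v \<pi>'"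
    using assms by (intro mult_minus_distrib_mat_vec[of _ n m]) auto
  moreover have "G *\<^sub>v (\<mu> - \<mu>') = G *\<^sub>v \<mu> - G *\<^sub>v \<mu>'"
    using assms by (intro mult_minus_distrib_mat_vec[of _ p k]) auto
  moreover have "transpose_mat B *\<^sub>v (G *\<^sub>v \<mu> - G *\<^sub>v \<mu>')
      = transpose_mat B *\<^sub>v (G *\<^sub>v \<mu>) - transpose_mat B *\<^sub>v (G *\<^sub>v \<mu>')"
    using assms by (intro mult_minus_distrib_mat_vec[of _ n p]) auto
  ultimately show ?thesis
    using assms by (intro eq_vecI) (auto simp: dual_lhs_def simp del: index_mult_mat_vec)
qed

text \<open>Weights attached to columns are treated as a signed measure on vectors, and the test
  functions \<open>\<phi>\<close> express that both index sets carry the same measure. Coordinates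
  as test functions yield equal matrix-vector products, the constant 1 yields equal total
  weight.\<close>

lemma pushforward_weights:
  fixes G1 G2 :: "real mat" and \<mu>1 \<mu>2 :: "real vec"
  assumes eq: "(\<lambda>j. col G1 j) ` {j. j < dim_col G1 \<and> \<mu>1 $ j \<noteq> 0}
             = (\<lambda>j. col G2 j) ` {j. j < dim_col G2 \<and> \<mu>2 $ j \<noteq> 0}"
  obtains \<nu> where "\<nu> \<in> carrier_vec (dim_col G1)"
    "\<And>j. j < dim_col G1 \<Longrightarrow> \<mu>1 $ j = 0 \<Longrightarrow> \<nu> $ j = 0"
    "\<And>\<phi> :: real vec \<Rightarrow> real.
       (\<Sum>j<dim_col G1. \<phi> (col G1 j) * \<nu> $ j) = (\<Sum>j<dim_col G2. \<phi> (col G2 j) * \<mu>2 $ j)"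
proof -
  let ?J1 = "{j. j < dim_col G1 \<and> \<mu>1 $ j \<noteq> 0}" and ?J2 = "{j. j < dim_col G2 \<and> \<mu>2 $ j \<noteq> 0}"
  define S where "S = (\<lambda>j. col G2 j) ` ?J2"
  have fin: "finite S" by (auto simp: S_def)
  \<comment> \<open>One index is kept for each distinct column, chosen where \<open>\<mu>1\<close>
    is nonzero: basicness of the first solution only speaks about perturbations inside its
    support.\<close>
  define r where "r = inv_into ?J1 (col G1)"
  have S1: "S = col G1 ` ?J1" using eq S_def by simp
  have r: "r v \<in> ?J1" "col G1 (r v) = v" if "v \<in> S" for v
  proof -
    show "r v \<in> ?J1" unfolding r_def using that S1 by (intro inv_into_into) simp
    show "col G1 (r v) = v" unfolding r_def using that S1 by (intro f_inv_into_f) simp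
  qed
  have inj: "inj_on r S" by (metis inj_onI r(2))
  define m where "m v = (\<Sum>j | j \<in> ?J2 \<and> col G2 j = v. \<mu>2 $ j)" for v
  define \<nu> where "\<nu> = vec (dim_col G1) (\<lambda>j. if j \<in> r ` S then m (col G1 j) else 0)"
  have "(\<Sum>j<dim_col G1. \<phi> (col G1 j) * \<nu> $ j) = (\<Sum>j<dim_col G2. \<phi> (col G2 j) * \<mu>2 $ j)"
    for \<phi> :: "real vec \<Rightarrow> real"
  proof -
    have "(\<Sum>j<dim_col G1. \<phi> (col G1 j) * \<nu> $ j) = (\<Sum>j\<in>r ` S. \<phi> (col G1 j) * m (col G1 j))"
      using r by (intro sum.mono_neutral_cong_right) (auto simp: \<nu>_def)
    also have "\<dots> = (\<Sum>v\<in>S. \<phi> v * m v)"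
      using inj r by (subst sum.reindex) (auto intro!: sum.cong)
    also have "\<dots> = (\<Sum>v\<in>S. \<Sum>j | j \<in> ?J2 \<and> col G2 j = v. \<phi> (col G2 j) * \<mu>2 $ j)"
      by (auto simp: m_def sum_distrib_left intro!: sum.cong)
    also have "\<dots> = (\<Sum>j\<in>?J2. \<phi> (col G2 j) * \<mu>2 $ j)"
      using sum.group[of ?J2 S "col G2" "\<lambda>j. \<phi> (col G2 j) * \<mu>2 $ j"] fin by (auto simp: S_def)
    also have "\<dots> = (\<Sum>j<dim_col G2. \<phi> (col G2 j) * \<mu>2 $ j)"
      by (intro sum.mono_neutral_cong_left) auto
    finally show ?thesis .
  qed
  moreover have "\<nu> $ j = 0" if "j < dim_col G1" "\<mu>1 $ j = 0" for j
    using that r by (auto simp: \<nu>_def)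
  ultimately show thesis using that[of \<nu>] by (auto simp: \<nu>_def)
qed

text \<open>The matrices may repeat columns and differ in size, so the second solution is first transported to
  the columns of \<open>G1\<close> by summing its weights over equal columns.\<close>

lemma basic_dual_multiplier_unique:
  assumes A: "A \<in> carrier_mat m n" and B: "B \<in> carrier_mat p n"
    and G1: "G1 \<in> carrier_mat p k1" and G2: "G2 \<in> carrier_mat p k2"
    and feas1: "dual_feasible A B G1 c (\<pi>1, \<mu>1, s1)" and basic: "dual_basic A B G1 (\<pi>1, \<mu>1, s1)"
    and feas2: "dual_feasible A B G2 c (\<pi>2, \<mu>2, s2)"
    and supp_\<pi>: "{i. i < m \<and> \<pi>1 $ i \<noteq> 0} = {i. i < m \<and> \<pi>2 $ i \<noteq> 0}"
    and supp_s: "{l. l < n \<and> s1 $ l \<noteq> 0} = {l. l < n \<and> s2 $ l \<noteq> 0}"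
    and supp_\<mu>: "(\<lambda>j. col G1 j) ` {j. j < k1 \<and> \<mu>1 $ j \<noteq> 0}
             = (\<lambda>j. col G2 j) ` {j. j < k2 \<and> \<mu>2 $ j \<noteq> 0}"
  shows "\<pi>1 = \<pi>2"
proof -
  obtain \<nu> where \<nu>: "\<nu> \<in> carrier_vec k1" and \<nu>0: "\<And>j. j < k1 \<Longrightarrow> \<mu>1 $ j = 0 \<Longrightarrow> \<nu> $ j = 0"
    and push: "\<And>\<phi> :: real vec \<Rightarrow> real.
       (\<Sum>j<k1. \<phi> (col G1 j) * \<nu> $ j) = (\<Sum>j<k2. \<phi> (col G2 j) * \<mu>2 $ j)"
    using pushforward_weights[of G1 \<mu>1 G2 \<mu>2] supp_\<mu> G1 G2 by auto
  have car: "\<pi>1 \<in> carrier_vec m" "\<mu>1 \<in> carrier_vec k1" "s1 \<in> carrier_vec n"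
    "\<pi>2 \<in> carrier_vec m" "\<mu>2 \<in> carrier_vec k2" "s2 \<in> carrier_vec n"
    using feas1 feas2 A G1 G2 by (auto simp: dual_feasible_def dual_space_def)
  have "(G1 *\<^sub>v \<nu>) $ r = (G2 *\<^sub>v \<mu>2) $ r" if "r < p" for r
    using push[of "\<lambda>v. v $ r"] that G1 G2 \<nu> car
    by (simp add: mult_mat_vec_index_sum del: index_mult_mat_vec)
  then have "G1 *\<^sub>v \<nu> = G2 *\<^sub>v \<mu>2"
    using G1 G2 by (intro eq_vecI) (auto simp del: index_mult_mat_vec)
  then have "dual_lhs A B G1 (\<pi>2, \<nu>, s2) = dual_lhs A B G2 (\<pi>2, \<mu>2, s2)"
    by (simp add: dual_lhs_def)
  moreover have "dual_lhs A B G2 (\<pi>2, \<mu>2, s2) = c" "dual_lhs A B G1 (\<pi>1, \<mu>1, s1) = c"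
    using feas1 feas2 by (auto simp: dual_feasible_def)
  ultimately have "dual_lhs A B G1 (\<pi>1 - \<pi>2, \<mu>1 - \<nu>, s1 - s2) = c - c"
    using dual_lhs_diff[OF A B G1 car(1-3) car(4) \<nu> car(6)] by simp
  moreover have "c \<in> carrier_vec n"
    using feas1 car(3) by (auto simp: dual_feasible_def dual_lhs_def intro!: carrier_vecI)
  ultimately have lhs: "dual_lhs A B G1 (\<pi>1 - \<pi>2, \<mu>1 - \<nu>, s1 - s2) = 0\<^sub>v n"
    by simp
  \<comment> \<open>The weights are normalized only when there is at least one cut. Equality of the
    used columns excludes that just one of the matrices has columns, because weights of total 1
    cannot all vanish.\<close>
  have "(\<Sum>j<k2. \<mu>2 $ j) = (\<Sum>j<k1. \<mu>1 $ j)"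
  proof -
    have 1: "0 < k1 \<Longrightarrow> (\<Sum>j<k1. \<mu>1 $ j) = 1" "0 < k2 \<Longrightarrow> (\<Sum>j<k2. \<mu>2 $ j) = 1"
      using feas1 feas2 G1 G2 by (auto simp: dual_feasible_def)
    have "k2 \<noteq> 0" if "k1 \<noteq> 0"
    proof -
      have "\<exists>j<k1. \<mu>1 $ j \<noteq> 0"
        using 1(1) that by (metis lessThan_iff neq0_conv sum.neutral zero_neq_one)
      then show ?thesis using supp_\<mu> by auto
    qed
    moreover have "k1 \<noteq> 0" if "k2 \<noteq> 0"
    proof -
      have "\<exists>j<k2. \<mu>2 $ j \<noteq> 0"
        using 1(2) that by (metis lessThan_iff neq0_conv sum.neutral zero_neq_one)
      then show ?thesis using supp_\<mu> by auto
    qed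
    ultimately show ?thesis using 1 by (cases "k1 = 0"; cases "k2 = 0") auto
  qed
  moreover have "(\<Sum>j<k1. \<nu> $ j) = (\<Sum>j<k2. \<mu>2 $ j)"
    using push[of "\<lambda>_. 1"] by simp
  ultimately have sum0: "(\<Sum>j<k1. (\<mu>1 - \<nu>) $ j) = 0"
    using \<nu> by (simp add: sum_subtractf)
  \<comment> \<open>The difference solves the homogeneous system and vanishes wherever the first
    solution does, so basicness forces it to be zero.\<close>
  have "(\<pi>1 - \<pi>2, \<mu>1 - \<nu>, s1 - s2) \<in> dual_space A G1"
    using A G1 car \<nu> by (auto simp: dual_space_def)
  moreover have "(\<pi>1 - \<pi>2) $ i = 0" if "i < m" "\<pi>1 $ i = 0" for i
    using supp_\<pi> that car by auto
  moreover have "(\<mu>1 - \<nu>) $ j = 0" if "j < k1" "\<mu>1 $ j = 0" for j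
    using \<nu>0 that \<nu> by auto
  moreover have "(s1 - s2) $ l = 0" if "l < n" "s1 $ l = 0" for l
    using supp_s that car by auto
  ultimately have "\<pi>1 - \<pi>2 = 0\<^sub>v m"
    using basic[unfolded dual_basic_def split, rule_format, of "(\<pi>1 - \<pi>2, \<mu>1 - \<nu>, s1 - s2)"]
      lhs sum0 A G1 by simp
  then have "(\<pi>1 - \<pi>2) $ i = 0" if "i < m" for i using that by simp
  then show ?thesis using car by (intro eq_vecI) auto
qed

text \<open>\<open>G\<close> gains a column with every iteration, so bases cannot be counted by
  column indices. By the uniqueness lemma the multiplier is fixed by finite data: the supports of
  \<open>\<pi>\<close> and \<open>s\<close>, and the set of vectors of \<open>C\<close> that carry
  weight.\<close>

lemma finite_basic_dual_multipliers:
  assumes A: "A \<in> carrier_mat m n" and B: "B \<in> carrier_mat p n" and C: "finite C"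
  shows "finite {\<pi>. \<exists>G \<mu> s. dim_row G = p \<and> set (cols G) \<subseteq> C \<and>
    dual_feasible A B G c (\<pi>, \<mu>, s) \<and> dual_basic A B G (\<pi>, \<mu>, s)}"
proof -
  define F where "F = (\<lambda>(I, L, S). {\<pi>. \<exists>G \<mu> s. dim_row G = p \<and> set (cols G) \<subseteq> C \<and>
    dual_feasible A B G c (\<pi>, \<mu>, s) \<and> dual_basic A B G (\<pi>, \<mu>, s) \<and>
    {i. i < m \<and> \<pi> $ i \<noteq> 0} = I \<and> {l. l < n \<and> s $ l \<noteq> 0} = L \<and>
    (\<lambda>j. col G j) ` {j. j < dim_col G \<and> \<mu> $ j \<noteq> 0} = S})"
  have one: "\<pi> = \<pi>'" if h: "\<pi> \<in> F K" "\<pi>' \<in> F K" for \<pi> \<pi>' K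
  proof -
    obtain I L S where K: "K = (I, L, S)" by (cases K) auto
    obtain G \<mu> s where 1: "dim_row G = p" "dual_feasible A B G c (\<pi>, \<mu>, s)"
      "dual_basic A B G (\<pi>, \<mu>, s)" "{i. i < m \<and> \<pi> $ i \<noteq> 0} = I" "{l. l < n \<and> s $ l \<noteq> 0} = L"
      "(\<lambda>j. col G j) ` {j. j < dim_col G \<and> \<mu> $ j \<noteq> 0} = S"
      using h(1) unfolding F_def K split mem_Collect_eq by blast
    obtain G' \<mu>' s' where 2: "dim_row G' = p" "dual_feasible A B G' c (\<pi>', \<mu>', s')"
      "{i. i < m \<and> \<pi>' $ i \<noteq> 0} = I" "{l. l < n \<and> s' $ l \<noteq> 0} = L"
      "(\<lambda>j. col G' j) ` {j. j < dim_col G' \<and> \<mu>' $ j \<noteq> 0} = S"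
      using h(2) unfolding F_def K split mem_Collect_eq by blast
    show ?thesis
      by (rule basic_dual_multiplier_unique[OF A B _ _ 1(2,3) 2(2)]) (use 1 2 in auto)
  qed
  have "finite (F K)" for K
  proof (cases "F K = {}")
    case False
    then obtain \<pi> where "\<pi> \<in> F K" by auto
    then have "F K \<subseteq> {\<pi>}" using one[where K = K] by blast
    then show ?thesis by (rule finite_subset) simp
  qed simp
  then have "finite (\<Union>K\<in>Pow {..<m} \<times> Pow {..<n} \<times> Pow C. F K)"
    using C by auto
  then show ?thesis
  proof (rule finite_subset[rotated], safe)
    fix \<pi> G \<mu> s
    assume *: "p = dim_row G" "set (cols G) \<subseteq> C" "dual_feasible A B G c (\<pi>, \<mu>, s)"
      "dual_basic A B G (\<pi>, \<mu>, s)"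
    let ?K = "({i. i < m \<and> \<pi> $ i \<noteq> 0}, {l. l < n \<and> s $ l \<noteq> 0},
      (\<lambda>j. col G j) ` {j. j < dim_col G \<and> \<mu> $ j \<noteq> 0})"
    have "\<pi> \<in> F ?K" unfolding F_def using * by auto
    moreover have "?K \<in> Pow {..<m} \<times> Pow {..<n} \<times> Pow C"
      using *(2) by (auto simp: cols_def)
    ultimately show "\<pi> \<in> (\<Union>K\<in>Pow {..<m} \<times> Pow {..<n} \<times> Pow C. F K)"
      by (rule UN_I[rotated])
  qed
qed

subsection \<open>Bounded families of polyhedra\<close>

text \<open>Bolzano-Weierstrass by successive extraction, one coordinate at a time. It is phrased
  with coordinates because the dimension of a vector is part of its value and not of its
  type.\<close>

lemma bounded_coordinates_convergent_subsequence:
  fixes f :: "nat \<Rightarrow> nat \<Rightarrow> real"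
  assumes "\<And>k i. i < n \<Longrightarrow> \<bar>f k i\<bar> \<le> C"
  shows "\<exists>r l. strict_mono r \<and> (\<forall>i<n. (\<lambda>k. f (r k) i) \<longlonglongrightarrow> l i)"
  using assms
proof (induction n)
  case 0
  show ?case using strict_mono_id by auto
next
  case (Suc n)
  then obtain r l where r: "strict_mono r" "\<And>i. i < n \<Longrightarrow> (\<lambda>k. f (r k) i) \<longlonglongrightarrow> l i"
    by (metis less_SucI)
  have "bounded (range (\<lambda>k. f (r k) n))"
    using Suc.prems[of n] by (auto simp: bounded_iff)
  then obtain a r' where r': "strict_mono r'" "((\<lambda>k. f (r k) n) \<circ> r') \<longlonglongrightarrow> a"
    using bounded_imp_convergent_subsequence by blast
  have "(\<lambda>k. f ((r \<circ> r') k) i) \<longlonglongrightarrow> (l(n := a)) i" if "i < Suc n" for i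
  proof (cases "i = n")
    case True
    then show ?thesis using r' by (simp add: o_def)
  next
    case False
    then show ?thesis
      using LIMSEQ_subseq_LIMSEQ[OF r(2) r'(1), of i] that by (simp add: o_def)
  qed
  then show ?case using strict_mono_o[OF r(1) r'(1)] by blast
qed

lemma bounded_vecs_subset: "bounded_vecs Y \<Longrightarrow> X \<subseteq> Y \<Longrightarrow> bounded_vecs X"
  unfolding bounded_vecs_def by blast

lemma bounded_vecs_UN_finite:
  assumes "finite I" "\<And>i. i \<in> I \<Longrightarrow> bounded_vecs (X i)"
  shows "bounded_vecs (\<Union>i\<in>I. X i)"
proof -
  obtain K where K: "\<And>i x j. i \<in> I \<Longrightarrow> x \<in> X i \<Longrightarrow> j < dim_vec x \<Longrightarrow> \<bar>x $ j\<bar> \<le> K i"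
    using assms(2) unfolding bounded_vecs_def by metis
  have "\<bar>x $ j\<bar> \<le> (\<Sum>i\<in>I. \<bar>K i\<bar>)" if "i \<in> I" "x \<in> X i" "j < dim_vec x" for i x j
    using K[OF that] member_le_sum[OF that(1), of "\<lambda>i. \<bar>K i\<bar>"] assms(1) by force
  then show ?thesis unfolding bounded_vecs_def by blast
qed

lemma scalar_prod_abs_le:
  fixes v x :: "real vec"
  assumes "\<And>i. i < dim_vec x \<Longrightarrow> \<bar>x $ i\<bar> \<le> K"
  shows "\<bar>v \<bullet> x\<bar> \<le> (\<Sum>i<dim_vec x. \<bar>v $ i\<bar>) * K"
proof -
  have "\<bar>v \<bullet> x\<bar> \<le> (\<Sum>i<dim_vec x. \<bar>v $ i * x $ i\<bar>)"
    unfolding scalar_prod_def lessThan_atLeast0 by (rule sum_abs)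
  also have "\<dots> \<le> (\<Sum>i<dim_vec x. \<bar>v $ i\<bar> * K)"
    using assms by (intro sum_mono) (auto simp: abs_mult intro!: mult_left_mono)
  finally show ?thesis by (simp add: sum_distrib_right)
qed

lemma bounded_vecs_mult_mat:
  assumes "bounded_vecs X" "B \<in> carrier_mat m n" "X \<subseteq> carrier_vec n"
  shows "bounded_vecs ((\<lambda>x. B *\<^sub>v x) ` X)"
proof -
  obtain K where K: "\<And>x i. x \<in> X \<Longrightarrow> i < n \<Longrightarrow> \<bar>x $ i\<bar> \<le> K"
    using assms unfolding bounded_vecs_def by (metis carrier_vecD subsetD)
  let ?a = "\<lambda>r. \<bar>(\<Sum>i<n. \<bar>row B r $ i\<bar>) * K\<bar>"
  have "\<bar>(B *\<^sub>v x) $ r\<bar> \<le> (\<Sum>r<m. ?a r)" if x: "x \<in> X" and r: "r < m" for x r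
  proof -
    have "dim_vec x = n" using assms(3) x by auto
    then have "\<bar>(B *\<^sub>v x) $ r\<bar> \<le> ?a r"
      using scalar_prod_abs_le[of x K "row B r"] K[OF x] r assms(2) by auto
    also have "\<dots> \<le> (\<Sum>r<m. ?a r)"
      using r by (intro member_le_sum) auto
    finally show ?thesis .
  qed
  then show ?thesis using assms(2) unfolding bounded_vecs_def by (intro exI[of _ "\<Sum>r<m. ?a r"]) auto
qed

lemma bounded_vecs_diff:
  assumes "bounded_vecs X" "bounded_vecs Y" "X \<subseteq> carrier_vec n" "Y \<subseteq> carrier_vec n"
  shows "bounded_vecs ((\<lambda>(x, y). x - y) ` (X \<times> Y))"
proof -
  obtain K where K: "\<And>x i. x \<in> X \<Longrightarrow> i < n \<Longrightarrow> \<bar>x $ i\<bar> \<le> K"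
    using assms unfolding bounded_vecs_def by (metis carrier_vecD subsetD)
  obtain L where L: "\<And>x i. x \<in> Y \<Longrightarrow> i < n \<Longrightarrow> \<bar>x $ i\<bar> \<le> L"
    using assms unfolding bounded_vecs_def by (metis carrier_vecD subsetD)
  have "\<bar>(x - y) $ i\<bar> \<le> K + L" if "x \<in> X" "y \<in> Y" "i < dim_vec (x - y)" for x y i
  proof -
    have d: "dim_vec x = n" "dim_vec y = n" using assms that by auto
    then show ?thesis using K[OF that(1), of i] L[OF that(2), of i] that d by auto
  qed
  then show ?thesis unfolding bounded_vecs_def by (intro exI[of _ "K + L"]) auto
qed

text \<open>An unbounded sequence of solutions yields, after normalization, a recession direction common to
  all the polyhedra, contradicting the boundedness of a single one.\<close>

lemma bounded_vecs_polyhedra: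
  fixes A :: "real mat"
  assumes A: "A \<in> carrier_mat m n" and b: "b \<in> carrier_vec m"
    and RS: "RS \<subseteq> carrier_vec m" "bounded_vecs RS"
    and bdd: "\<And>R. R \<in> RS \<Longrightarrow> bounded_vecs {x \<in> carrier_vec n. 0\<^sub>v n \<le> x \<and> R + A *\<^sub>v x = b}"
  shows "bounded_vecs (\<Union>R\<in>RS. {x \<in> carrier_vec n. 0\<^sub>v n \<le> x \<and> R + A *\<^sub>v x = b})"
    (is "bounded_vecs (\<Union>R\<in>RS. ?X R)")
proof (rule ccontr)
  assume unb: "\<not> ?thesis"
  define T where "T k R x i \<longleftrightarrow> R \<in> RS \<and> x \<in> ?X R \<and> i < n \<and> real k < \<bar>x $ i\<bar>" for k R x i
  have "\<exists>R x i. T k R x i" for k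
  proof (rule ccontr)
    assume "\<not> ?thesis"
    then have "\<bar>y $ i\<bar> \<le> real k" if "R \<in> RS" "y \<in> ?X R" "i < n" for R y i
      using that unfolding T_def not_less[symmetric] by blast
    then have "\<forall>y\<in>\<Union>R\<in>RS. ?X R. \<forall>i<dim_vec y. \<bar>y $ i\<bar> \<le> real k" by fastforce
    then show False using unb unfolding bounded_vecs_def by blast
  qed
  then obtain R x i where "\<And>k. T k (R k) (x k) (i k)" by metis
  then have R: "\<And>k. R k \<in> RS" and x: "\<And>k. x k \<in> carrier_vec n" "\<And>k. 0\<^sub>v n \<le> x k"
    "\<And>k. R k + A *\<^sub>v x k = b"
    and i: "\<And>k. i k < n" "\<And>k. real k < \<bar>x k $ i k\<bar>"
    unfolding T_def by blast+
  obtain K where "\<forall>R\<in>RS. \<forall>i<dim_vec R. \<bar>R $ i\<bar> \<le> K"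
    using RS(2) unfolding bounded_vecs_def by blast
  then have K: "\<bar>R $ i\<bar> \<le> K" if "R \<in> RS" "i < m" for R i
    using that RS(1) by auto
  have nonneg: "0 \<le> x k $ l" if "l < n" for k l
    using x(1,2)[of k] that by (auto simp: less_eq_vec_def)
  \<comment> \<open>On nonnegative vectors the coordinate sum is a norm; dividing by it bounds all
    coordinates by 1 and keeps the limit direction away from zero.\<close>
  define s where "s k = (\<Sum>l<n. x k $ l)" for k
  have le_s: "x k $ l \<le> s k" if "l < n" for k l
    unfolding s_def using nonneg that by (intro member_le_sum) auto
  have s_gt: "real k < s k" for k
    using le_s[OF i(1)[of k], of k] i(2)[of k] nonneg[OF i(1)[of k], of k] by linarith
  then have s_pos: "0 < s k" for k by (meson of_nat_0_le_iff order_le_less_trans)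
  have "\<bar>x k $ l / s k\<bar> \<le> 1" if "l < n" for k l
    using nonneg[OF that, of k] le_s[OF that, of k] s_pos[of k] by (simp add: divide_le_eq)
  then obtain r d where r: "strict_mono r" and lim: "\<And>l. l < n \<Longrightarrow> (\<lambda>k. x (r k) $ l / s (r k)) \<longlonglongrightarrow> d l"
    using bounded_coordinates_convergent_subsequence[of n "\<lambda>k l. x k $ l / s k" 1] by blast
  have d_nonneg: "0 \<le> d l" if "l < n" for l
    by (rule LIMSEQ_le_const[OF lim[OF that]]) (use nonneg[OF that] s_pos in \<open>auto intro!: divide_nonneg_pos\<close>)
  have "(\<lambda>k. \<Sum>l<n. x (r k) $ l / s (r k)) \<longlonglongrightarrow> (\<Sum>l<n. d l)"
    using lim by (intro tendsto_sum) auto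
  moreover have "(\<Sum>l<n. x (r k) $ l / s (r k)) = 1" for k
    using s_pos[of "r k"] unfolding s_def sum_divide_distrib[symmetric] by simp
  ultimately have d_sum: "(\<Sum>l<n. d l) = 1"
    by (simp add: LIMSEQ_const_iff)
  have s_inf: "filterlim s at_top sequentially"
    by (rule filterlim_at_top_mono[OF filterlim_real_sequentially]) (intro always_eventually allI less_imp_le s_gt)
  have sr_inf: "filterlim (\<lambda>k. s (r k)) at_top sequentially"
    using filterlim_compose[OF s_inf filterlim_subseq[OF r]] by simp
  \<comment> \<open>The right-hand sides \<open>b - R k\<close> stay bounded because
    \<open>RS\<close> is bounded, so they vanish in the limit after division by
    \<open>s\<close>.\<close>
  have Ad: "(\<Sum>l<n. A $$ (j, l) * d l) = 0" if j: "j < m" for j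
  proof -
    have row: "(\<Sum>l<n. A $$ (j, l) * x k $ l) = b $ j - R k $ j" for k
    proof -
      have "(R k + A *\<^sub>v x k) $ j = b $ j" "R k \<in> carrier_vec m" "x k \<in> carrier_vec n"
        using x[of k] R[of k] RS(1) by (simp_all add: subset_eq)
      then show ?thesis using j A by (auto simp: scalar_prod_def lessThan_atLeast0)
    qed
    have "(\<lambda>k. \<Sum>l<n. A $$ (j, l) * (x (r k) $ l / s (r k))) \<longlonglongrightarrow> (\<Sum>l<n. A $$ (j, l) * d l)"
      using lim by (intro tendsto_sum tendsto_mult) auto
    moreover have "(\<Sum>l<n. A $$ (j, l) * (x (r k) $ l / s (r k))) = (b $ j - R (r k) $ j) / s (r k)" for k
      unfolding row[symmetric] by (simp add: sum_divide_distrib)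
    moreover have "(\<lambda>k. (b $ j - R (r k) $ j) / s (r k)) \<longlonglongrightarrow> 0"
    proof (rule tendsto_rabs_zero_cancel,
        rule tendsto_sandwich[of "\<lambda>_. 0" _ _ "\<lambda>k. (\<bar>b $ j\<bar> + K) / s (r k)"])
      show "\<forall>\<^sub>F k in sequentially. \<bar>(b $ j - R (r k) $ j) / s (r k)\<bar> \<le> (\<bar>b $ j\<bar> + K) / s (r k)"
      proof (intro always_eventually allI)
        fix k
        have "\<bar>b $ j - R (r k) $ j\<bar> \<le> \<bar>b $ j\<bar> + K" using K[OF R[of "r k"] j] by linarith
        then show "\<bar>(b $ j - R (r k) $ j) / s (r k)\<bar> \<le> (\<bar>b $ j\<bar> + K) / s (r k)"
          using s_pos[of "r k"] by (simp add: divide_right_mono)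
      qed
      show "(\<lambda>k. (\<bar>b $ j\<bar> + K) / s (r k)) \<longlonglongrightarrow> 0"
        by (rule real_tendsto_divide_at_top[OF tendsto_const sr_inf])
    qed auto
    ultimately show ?thesis using LIMSEQ_unique by simp
  qed
  obtain l where l: "l < n" "0 < d l"
  proof -
    have "\<exists>l<n. 0 < d l"
    proof (rule ccontr)
      assume "\<not> ?thesis"
      then have "d l \<le> 0" if "l < n" for l using that not_less by blast
      then have "(\<Sum>l<n. d l) \<le> 0" by (intro sum_nonpos) simp
      with d_sum show False by simp
    qed
    then show thesis using that by blast
  qed
  obtain K' where "\<forall>y\<in>?X (R 0). \<forall>i<dim_vec y. \<bar>y $ i\<bar> \<le> K'"
    using bdd[OF R[of 0]] unfolding bounded_vecs_def by blast
  then have K': "\<bar>y $ l\<bar> \<le> K'" if "y \<in> ?X (R 0)" for y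
    using that l(1) by auto
  \<comment> \<open>Far enough along the recession direction to push coordinate \<open>l\<close>
    beyond the bound \<open>K'\<close> of the single polyhedron at \<open>R 0\<close>.\<close>
  define c where "c = (\<bar>K'\<bar> + 1) / d l"
  have c: "0 < c" using l by (simp add: c_def)
  have "x 0 + c \<cdot>\<^sub>v vec n d \<in> ?X (R 0)"
  proof -
    have x0: "x 0 \<in> carrier_vec n" "R 0 + A *\<^sub>v x 0 = b" using x(1,3) .
    have "A *\<^sub>v vec n d = 0\<^sub>v m"
      using Ad A by (intro eq_vecI) (auto simp: scalar_prod_def lessThan_atLeast0)
    then have "A *\<^sub>v (c \<cdot>\<^sub>v vec n d) = 0\<^sub>v m"
      using A by (subst mult_mat_vec[of _ m n]) auto
    then have "A *\<^sub>v (x 0 + c \<cdot>\<^sub>v vec n d) = A *\<^sub>v x 0"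
      using A x0 by (subst mult_add_distrib_mat_vec[of _ m n]) auto
    then show ?thesis
      using x0 c d_nonneg nonneg[of _ 0] by (auto simp: less_eq_vec_def)
  qed
  from K'[OF this] have "\<bar>x 0 $ l + c * d l\<bar> \<le> K'"
    using l x(1)[of 0] by auto
  then show False using nonneg[OF l(1), of 0] l by (simp add: c_def)
qed

subsection \<open>Exactness of small quadratic penalties\<close>

text \<open>The directions can be chosen according to the zero coordinates and the active affine pieces at
  \<open>x\<close> alone; this is what makes the set of directions finite and independent of the right-hand side
  of \<open>A x = q\<close>.\<close>

lemma finite_descent_directions:
  fixes A :: "real mat" and l :: "'j \<Rightarrow> real vec"
  assumes A: "A \<in> carrier_mat m n" and J: "finite J" and l: "\<And>j. j \<in> J \<Longrightarrow> l j \<in> carrier_vec n"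
  obtains D where "finite D" "D \<subseteq> carrier_vec n"
    "\<And>a x y M \<delta>. x \<in> carrier_vec n \<Longrightarrow> y \<in> carrier_vec n \<Longrightarrow> 0\<^sub>v n \<le> x \<Longrightarrow> 0\<^sub>v n \<le> y \<Longrightarrow>
      A *\<^sub>v x = A *\<^sub>v y \<Longrightarrow> 0 < \<delta> \<Longrightarrow> (\<And>j. j \<in> J \<Longrightarrow> a j + l j \<bullet> x \<le> M) \<Longrightarrow>
      (\<And>j. j \<in> J \<Longrightarrow> a j + l j \<bullet> y \<le> M - \<delta>) \<Longrightarrow>
      \<exists>d\<in>D. \<forall>\<^sub>F e in at_right 0. 0\<^sub>v n \<le> x + e \<cdot>\<^sub>v d \<and> A *\<^sub>v (x + e \<cdot>\<^sub>v d) = A *\<^sub>v x \<and>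
        (\<forall>j\<in>J. a j + l j \<bullet> (x + e \<cdot>\<^sub>v d) \<le> M - e)"
proof -
  \<comment> \<open>\<open>Z\<close> will be the zero coordinates of \<open>x\<close> and
    \<open>J'\<close> its active pieces. The rate -1 fixes the scale, so that a small step
    \<open>e\<close> gains at least \<open>e\<close>.\<close>
  define dir where "dir = (\<lambda>(Z, J') d. d \<in> carrier_vec n \<and> A *\<^sub>v d = 0\<^sub>v m \<and>
    (\<forall>i\<in>Z. 0 \<le> d $ i) \<and> (\<forall>j\<in>J'. l j \<bullet> d \<le> -1))"
  define K where "K = {K \<in> Pow {..<n} \<times> Pow J. \<exists>d. dir K d}"
  define D where "D = (\<lambda>K. SOME d. dir K d) ` K"
  have dirD: "dir k (SOME d. dir k d)" if "k \<in> K" for k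
    using that unfolding K_def by (auto intro: someI_ex)
  have "finite K" unfolding K_def using J by auto
  then have "finite D" by (simp add: D_def)
  moreover have "D \<subseteq> carrier_vec n"
    using dirD by (auto simp: D_def dir_def split: prod.splits)
  moreover have "\<exists>d\<in>D. \<forall>\<^sub>F e in at_right 0. 0\<^sub>v n \<le> x + e \<cdot>\<^sub>v d \<and> A *\<^sub>v (x + e \<cdot>\<^sub>v d) = A *\<^sub>v x \<and>
        (\<forall>j\<in>J. a j + l j \<bullet> (x + e \<cdot>\<^sub>v d) \<le> M - e)"
    if x: "x \<in> carrier_vec n" "0\<^sub>v n \<le> x" and y: "y \<in> carrier_vec n" "0\<^sub>v n \<le> y"
      and Axy: "A *\<^sub>v x = A *\<^sub>v y" and \<delta>: "0 < \<delta>" and Mx: "\<And>j. j \<in> J \<Longrightarrow> a j + l j \<bullet> x \<le> M"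
      and My: "\<And>j. j \<in> J \<Longrightarrow> a j + l j \<bullet> y \<le> M - \<delta>" for a x y M \<delta>
  proof -
    define Z where "Z = {i. i < n \<and> x $ i = 0}"
    define J' where "J' = {j \<in> J. a j + l j \<bullet> x = M}"
    \<comment> \<open>Moving towards the better point \<open>y\<close> is such a direction: the
      active pieces fall by at least \<open>\<delta>\<close> on the way, hence the factor
      \<open>1 / \<delta>\<close>.\<close>
    have "dir (Z, J') ((1 / \<delta>) \<cdot>\<^sub>v (y - x))"
      unfolding dir_def split
    proof (intro conjI ballI)
      show "A *\<^sub>v ((1 / \<delta>) \<cdot>\<^sub>v (y - x)) = 0\<^sub>v m"
        using A x y Axy
        by (subst mult_mat_vec[of _ m n], simp, simp, subst mult_minus_distrib_mat_vec[of _ m n]) auto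
      show "0 \<le> ((1 / \<delta>) \<cdot>\<^sub>v (y - x)) $ i" if "i \<in> Z" for i
        using that x y \<delta> by (auto simp: Z_def less_eq_vec_def)
      show "l j \<bullet> ((1 / \<delta>) \<cdot>\<^sub>v (y - x)) \<le> -1" if "j \<in> J'" for j
      proof -
        have j: "j \<in> J" "a j + l j \<bullet> x = M" using that by (auto simp: J'_def)
        have "l j \<bullet> ((1 / \<delta>) \<cdot>\<^sub>v (y - x)) = (1 / \<delta>) * (l j \<bullet> y - l j \<bullet> x)"
          using x y l[OF j(1)] by (simp add: scalar_prod_minus_distrib[of _ n])
        also have "\<dots> \<le> (1 / \<delta>) * (- \<delta>)"
          using My[OF j(1)] j(2) \<delta> by (intro mult_left_mono) auto
        finally show ?thesis using \<delta> by simp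
      qed
    qed (use x y in auto)
    then have ZJ: "(Z, J') \<in> K" by (auto simp: K_def Z_def J'_def)
    define d where "d = (SOME d. dir (Z, J') d)"
    have dD: "d \<in> D" using ZJ by (auto simp: D_def d_def)
    have d: "d \<in> carrier_vec n" "A *\<^sub>v d = 0\<^sub>v m" "\<And>i. i \<in> Z \<Longrightarrow> 0 \<le> d $ i"
      "\<And>j. j \<in> J' \<Longrightarrow> l j \<bullet> d \<le> -1"
      using dirD[OF ZJ] unfolding d_def[symmetric] by (auto simp: dir_def)
    have pos: "\<forall>\<^sub>F e in at_right (0::real). 0 < e"
      by (simp add: eventually_at_right_less)
    \<comment> \<open>The conditions in \<open>dir\<close> settle the zero coordinates and the
      active pieces; the remaining ones have slack and tolerate every sufficiently small
      step.\<close>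
    have "\<forall>\<^sub>F e in at_right 0. \<forall>i\<in>{..<n}. 0 \<le> x $ i + e * d $ i"
    proof (intro eventually_ball_finite ballI)
      fix i assume i: "i \<in> {..<n}"
      show "\<forall>\<^sub>F e in at_right 0. 0 \<le> x $ i + e * d $ i"
      proof (cases "i \<in> Z")
        case True
        then show ?thesis using d(3) pos by (auto elim!: eventually_mono simp: Z_def)
      next
        case False
        have "((\<lambda>e. x $ i + e * d $ i) \<longlongrightarrow> x $ i + 0 * d $ i) (at_right 0)"
          by (intro tendsto_intros)
        moreover have "0 < x $ i + 0 * d $ i"
          using False i x by (auto simp: Z_def less_eq_vec_def less_le)
        ultimately have "\<forall>\<^sub>F e in at_right 0. 0 < x $ i + e * d $ i"
          by (rule order_tendstoD(1))
        then show ?thesis by (auto elim!: eventually_mono)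
      qed
    qed simp
    moreover have "\<forall>\<^sub>F e in at_right 0. \<forall>j\<in>J. a j + l j \<bullet> x + e * (l j \<bullet> d) \<le> M - e"
    proof (intro eventually_ball_finite ballI)
      fix j assume j: "j \<in> J"
      show "\<forall>\<^sub>F e in at_right 0. a j + l j \<bullet> x + e * (l j \<bullet> d) \<le> M - e"
      proof (cases "j \<in> J'")
        case True
        show ?thesis using pos
        proof eventually_elim
          case (elim e)
          have "e * (l j \<bullet> d) \<le> e * (- 1)" using elim d(4)[OF True] by (intro mult_left_mono) auto
          then show ?case using True by (auto simp: J'_def)
        qed
      next
        case False
        have "((\<lambda>e. a j + l j \<bullet> x + e * (l j \<bullet> d) + e) \<longlongrightarrow> a j + l j \<bullet> x + 0 * (l j \<bullet> d) + 0) (at_right 0)"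
          by (intro tendsto_intros)
        moreover have "a j + l j \<bullet> x + 0 * (l j \<bullet> d) + 0 < M"
          using False j Mx[OF j] by (auto simp: J'_def)
        ultimately have "\<forall>\<^sub>F e in at_right 0. a j + l j \<bullet> x + e * (l j \<bullet> d) + e < M"
          by (rule order_tendstoD(2))
        then show ?thesis by (auto elim!: eventually_mono)
      qed
    qed (use J in simp)
    ultimately have "\<forall>\<^sub>F e in at_right 0. 0\<^sub>v n \<le> x + e \<cdot>\<^sub>v d \<and> A *\<^sub>v (x + e \<cdot>\<^sub>v d) = A *\<^sub>v x \<and>
        (\<forall>j\<in>J. a j + l j \<bullet> (x + e \<cdot>\<^sub>v d) \<le> M - e)"
    proof eventually_elim
      case (elim e)
      have "A *\<^sub>v (e \<cdot>\<^sub>v d) = 0\<^sub>v m"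
        using A d by (subst mult_mat_vec[of _ m n]) auto
      then have "A *\<^sub>v (x + e \<cdot>\<^sub>v d) = A *\<^sub>v x"
        using A x d by (subst mult_add_distrib_mat_vec[of _ m n]) auto
      moreover have "l j \<bullet> (x + e \<cdot>\<^sub>v d) = l j \<bullet> x + e * (l j \<bullet> d)" if "j \<in> J" for j
        using x d l[OF that] by (simp add: scalar_prod_add_distrib[of _ n])
      ultimately show ?case
        using elim x d by (auto simp: less_eq_vec_def add.assoc)
    qed
    then show ?thesis using dD by blast
  qed
  ultimately show thesis by (rule that)
qed

text \<open>Symmetry of \<open>Q\<close> merges the two cross terms into one, whose factor
  \<open>(Q *v v) \<bullet> u\<close> is the slope that has to be bounded over all deviations
  \<open>u\<close> from the incumbent.\<close>

lemma quadratic_form_line: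
  fixes Q :: "real mat"
  assumes Q: "Q \<in> carrier_mat p p" "transpose_mat Q = Q" and u: "u \<in> carrier_vec p" and v: "v \<in> carrier_vec p"
  shows "(u + e \<cdot>\<^sub>v v) \<bullet> (Q *\<^sub>v (u + e \<cdot>\<^sub>v v)) =
    u \<bullet> (Q *\<^sub>v u) + 2 * e * ((Q *\<^sub>v v) \<bullet> u) + e\<^sup>2 * (v \<bullet> (Q *\<^sub>v v))"
proof -
  have Qu: "Q *\<^sub>v u \<in> carrier_vec p" and Qv: "Q *\<^sub>v v \<in> carrier_vec p" using Q u v by auto
  have 1: "Q *\<^sub>v (u + e \<cdot>\<^sub>v v) = Q *\<^sub>v u + e \<cdot>\<^sub>v (Q *\<^sub>v v)"
    using Q u v by (simp add: mult_add_distrib_mat_vec[of _ p p] mult_mat_vec[of _ p p])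
  have 2: "v \<bullet> (Q *\<^sub>v u) = (Q *\<^sub>v v) \<bullet> u"
    using transpose_vec_mult_scalar[of Q p p u v] Q u v by simp
  have 3: "u \<bullet> (Q *\<^sub>v v) = (Q *\<^sub>v v) \<bullet> u"
    using u Qv by (rule comm_scalar_prod)
  have "(u + e \<cdot>\<^sub>v v) \<bullet> (Q *\<^sub>v u + e \<cdot>\<^sub>v (Q *\<^sub>v v)) =
      u \<bullet> (Q *\<^sub>v u) + e * (u \<bullet> (Q *\<^sub>v v)) + (e * (v \<bullet> (Q *\<^sub>v u)) + e * (e * (v \<bullet> (Q *\<^sub>v v))))"
    using u v Qu Qv by (simp add: add_scalar_prod_distrib[of _ p] scalar_prod_add_distrib[of _ p]
        distrib_left)
  then show ?thesis unfolding 1 2 3 by (simp add: power2_eq_square)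
qed

text \<open>Along a descent direction of unit rate the piecewise linear part gains \<open>e\<close> whereas the penalty
  loses at most \<open>\<rho> L e + O(e\<^sup>2)\<close>, where \<open>L\<close> bounds the slope of the quadratic form.\<close>

lemma regularized_minimizer_exact:
  fixes A Q B :: "real mat" and l :: "'j \<Rightarrow> real vec"
  assumes A: "A \<in> carrier_mat m n" and B: "B \<in> carrier_mat p n"
    and Q: "Q \<in> carrier_mat p p" "transpose_mat Q = Q"
    and J: "finite J" "J \<noteq> {}" and l: "\<And>j. j \<in> J \<Longrightarrow> l j \<in> carrier_vec n"
    and U: "U \<subseteq> carrier_vec p" "bounded_vecs U"
  obtains \<rho>0 where "0 < \<rho>0"
    "\<And>\<rho> a x y r. x \<in> carrier_vec n \<Longrightarrow> y \<in> carrier_vec n \<Longrightarrow> r \<in> carrier_vec p \<Longrightarrow>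
      0\<^sub>v n \<le> x \<Longrightarrow> 0\<^sub>v n \<le> y \<Longrightarrow> A *\<^sub>v x = A *\<^sub>v y \<Longrightarrow> B *\<^sub>v x - r \<in> U \<Longrightarrow> 0 \<le> \<rho> \<Longrightarrow> \<rho> < \<rho>0 \<Longrightarrow>
      (\<And>x'. x' \<in> carrier_vec n \<Longrightarrow> 0\<^sub>v n \<le> x' \<Longrightarrow> A *\<^sub>v x' = A *\<^sub>v x \<Longrightarrow>
        Max ((\<lambda>j. a j + l j \<bullet> x) ` J) + \<rho> / 2 * ((B *\<^sub>v x - r) \<bullet> (Q *\<^sub>v (B *\<^sub>v x - r))) \<le>
        Max ((\<lambda>j. a j + l j \<bullet> x') ` J) + \<rho> / 2 * ((B *\<^sub>v x' - r) \<bullet> (Q *\<^sub>v (B *\<^sub>v x' - r)))) \<Longrightarrow>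
      Max ((\<lambda>j. a j + l j \<bullet> x) ` J) \<le> Max ((\<lambda>j. a j + l j \<bullet> y) ` J)"
proof (rule finite_descent_directions[where l = l, OF A J(1)], goal_cases)
  case (1 j)
  from l[OF 1(2)] show ?case .
next
  case (2 D)
  note D = 2(2,3) and desc = 2(4)
  obtain K where "\<forall>u\<in>U. \<forall>i<dim_vec u. \<bar>u $ i\<bar> \<le> K"
    using U unfolding bounded_vecs_def by blast
  then have K: "\<And>u i. u \<in> U \<Longrightarrow> i < p \<Longrightarrow> \<bar>u $ i\<bar> \<le> K" using U(1) by auto
  \<comment> \<open>\<open>c d\<close> bounds the slope of the quadratic form along \<open>d\<close>
    over all of \<open>U\<close>, through the coordinate bound \<open>K\<close>. The added 1 makes
    \<open>L\<close> positive and the bound \<open>cL\<close> strict; the threshold will be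
    \<open>1 / L\<close>.\<close>
  define c where "c d = (\<Sum>i<p. \<bar>(Q *\<^sub>v (B *\<^sub>v d)) $ i\<bar>) * K" for d
  define L where "L = (\<Sum>d\<in>D. \<bar>c d\<bar>) + 1"
  have L: "0 < L" unfolding L_def by (intro add_nonneg_pos sum_nonneg) auto
  have cL: "(Q *\<^sub>v (B *\<^sub>v d)) \<bullet> u < L" if "d \<in> D" "u \<in> U" for d u
  proof -
    have "dim_vec u = p" using that U by auto
    then have "(Q *\<^sub>v (B *\<^sub>v d)) \<bullet> u \<le> \<bar>c d\<bar>"
      using scalar_prod_abs_le[of u K "Q *\<^sub>v (B *\<^sub>v d)"] K[OF that(2)] by (auto simp: c_def)
    also have "\<dots> \<le> (\<Sum>d\<in>D. \<bar>c d\<bar>)" using D that by (intro member_le_sum) auto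
    finally show ?thesis by (simp add: L_def)
  qed
  have "Max ((\<lambda>j. a j + l j \<bullet> x) ` J) \<le> Max ((\<lambda>j. a j + l j \<bullet> y) ` J)" (is "?f x \<le> ?f y")
    if x: "x \<in> carrier_vec n" "0\<^sub>v n \<le> x" and y: "y \<in> carrier_vec n" "0\<^sub>v n \<le> y"
      and r: "r \<in> carrier_vec p" and Axy: "A *\<^sub>v x = A *\<^sub>v y" and U': "B *\<^sub>v x - r \<in> U"
      and \<rho>: "0 \<le> \<rho>" "\<rho> < 1 / L"
      and min: "\<And>x'. x' \<in> carrier_vec n \<Longrightarrow> 0\<^sub>v n \<le> x' \<Longrightarrow> A *\<^sub>v x' = A *\<^sub>v x \<Longrightarrow>
        Max ((\<lambda>j. a j + l j \<bullet> x) ` J) + \<rho> / 2 * ((B *\<^sub>v x - r) \<bullet> (Q *\<^sub>v (B *\<^sub>v x - r))) \<le>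
        Max ((\<lambda>j. a j + l j \<bullet> x') ` J) + \<rho> / 2 * ((B *\<^sub>v x' - r) \<bullet> (Q *\<^sub>v (B *\<^sub>v x' - r)))"
    for \<rho> a x y r
  proof (rule ccontr)
    assume "\<not> ?f x \<le> ?f y"
    \<comment> \<open>However small this excess is, the direction obtained from it has unit rate;
      this is why one threshold serves all pairs of points.\<close>
    then have \<delta>: "0 < ?f x - ?f y" by simp
    have "a j + l j \<bullet> x \<le> ?f x" "a j + l j \<bullet> y \<le> ?f x - (?f x - ?f y)" if "j \<in> J" for j
      using that J by auto
    from desc[OF x(1) y(1) x(2) y(2) Axy \<delta> this] obtain d where d: "d \<in> D" and
      ev: "\<forall>\<^sub>F e in at_right 0. 0\<^sub>v n \<le> x + e \<cdot>\<^sub>v d \<and> A *\<^sub>v (x + e \<cdot>\<^sub>v d) = A *\<^sub>v x \<and>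
        (\<forall>j\<in>J. a j + l j \<bullet> (x + e \<cdot>\<^sub>v d) \<le> ?f x - e)"
      by blast
    define u where "u = B *\<^sub>v x - r"
    define v where "v = B *\<^sub>v d"
    have dn: "d \<in> carrier_vec n" using d D by auto
    have uv: "u \<in> carrier_vec p" "v \<in> carrier_vec p" using r B x dn by (auto simp: u_def v_def)
    have line: "B *\<^sub>v (x + e \<cdot>\<^sub>v d) - r = u + e \<cdot>\<^sub>v v" for e
    proof -
      have "B *\<^sub>v (x + e \<cdot>\<^sub>v d) = B *\<^sub>v x + e \<cdot>\<^sub>v v"
        using x dn B by (simp add: mult_add_distrib_mat_vec[of _ p n] mult_mat_vec[of _ p n] v_def)
      then show ?thesis
        using r B by (intro eq_vecI) (auto simp: u_def v_def simp del: index_mult_mat_vec)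
    qed
    have bound: "\<rho> * ((Q *\<^sub>v v) \<bullet> u) < 1"
    proof -
      have "(Q *\<^sub>v v) \<bullet> u < L" using cL[OF d, of u] U' by (simp add: u_def v_def)
      then have "\<rho> * ((Q *\<^sub>v v) \<bullet> u) \<le> \<rho> * L" using \<rho> by (intro mult_left_mono) auto
      also have "\<rho> * L < 1" using \<rho> L by (simp add: pos_less_divide_eq)
      finally show ?thesis .
    qed
    have "((\<lambda>e. \<rho> * ((Q *\<^sub>v v) \<bullet> u) + \<rho> / 2 * e * (v \<bullet> (Q *\<^sub>v v))) \<longlongrightarrow>
      \<rho> * ((Q *\<^sub>v v) \<bullet> u) + \<rho> / 2 * 0 * (v \<bullet> (Q *\<^sub>v v))) (at_right 0)"
      by (intro tendsto_intros)
    then have "\<forall>\<^sub>F e in at_right 0. \<rho> * ((Q *\<^sub>v v) \<bullet> u) + \<rho> / 2 * e * (v \<bullet> (Q *\<^sub>v v)) < 1"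
      using bound by (intro order_tendstoD(2)) auto
    moreover have "\<forall>\<^sub>F e in at_right (0::real). 0 < e"
      by (simp add: eventually_at_right_less)
    ultimately have "\<forall>\<^sub>F e in at_right (0::real). False"
      using ev
    proof eventually_elim
      case (elim e)
      have "?f (x + e \<cdot>\<^sub>v d) \<le> ?f x - e"
        using elim J by (subst Max_le_iff) auto
      moreover have "?f x + \<rho> / 2 * (u \<bullet> (Q *\<^sub>v u)) \<le>
          ?f (x + e \<cdot>\<^sub>v d) + \<rho> / 2 * ((u + e \<cdot>\<^sub>v v) \<bullet> (Q *\<^sub>v (u + e \<cdot>\<^sub>v v)))"
        using min[of "x + e \<cdot>\<^sub>v d"] elim x dn by (simp add: line u_def)
      ultimately have "e \<le> \<rho> / 2 * (2 * e * ((Q *\<^sub>v v) \<bullet> u) + e\<^sup>2 * (v \<bullet> (Q *\<^sub>v v)))"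
        unfolding quadratic_form_line[OF Q uv] by (simp add: algebra_simps)
      also have "\<dots> = e * (\<rho> * ((Q *\<^sub>v v) \<bullet> u) + \<rho> / 2 * e * (v \<bullet> (Q *\<^sub>v v)))"
        by (simp add: algebra_simps power2_eq_square)
      also have "\<dots> < e * 1" using elim by (intro mult_strict_left_mono) auto
      finally show ?case by simp
    qed
    then show False by (simp add: trivial_limit_at_right_real)
  qed
  moreover have "0 < 1 / L" using L by simp
  ultimately show thesis by (rule that[rotated])
qed

subsection \<open>Cuts along a path of the method\<close>

lemma stage_value_mono:
  assumes "\<And>x. x \<in> feasible P t R w \<Longrightarrow> W (matB P t w *\<^sub>v x) (info P t w) \<le> W' (matB P t w *\<^sub>v x) (info P t w)"
  shows "stage_value P W t R w \<le> stage_value P W' t R w"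
  unfolding stage_value_def using assms by (intro INF_mono) (auto intro: add_left_mono)

lemma trans_prob_nonneg: "0 \<le> trans_prob P t i w"
  by (simp add: trans_prob_def cond_prob_def)

lemma expected_stage_value_mono:
  assumes "\<And>w. w \<in> realizations P (Suc t) \<Longrightarrow>
    stage_value P W (Suc t) R w \<le> stage_value P W' (Suc t) R w"
  shows "expected_stage_value P W t R i \<le> expected_stage_value P W' t R i"
  unfolding expected_stage_value_def using assms
  by (intro sum_mono ereal_mult_left_mono) (auto simp: trans_prob_nonneg)

lemma cut_slope_carrier [simp]: "cut_slope P h t i \<in> carrier_vec (nrow P (Suc t))"
  by (simp add: cut_slope_def)

lemma cut_slope_cong:
  assumes "\<And>w. w \<in> realizations P (Suc t) \<Longrightarrow> h w = h' w"
  shows "cut_slope P h t i = cut_slope P h' t i"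
  unfolding cut_slope_def using assms by (auto intro!: eq_vecI sum.cong)

lemma cut_slope_scalar_prod:
  assumes "d \<in> carrier_vec (nrow P (Suc t))"
    and "\<And>w. w \<in> realizations P (Suc t) \<Longrightarrow> h w \<in> carrier_vec (nrow P (Suc t))"
  shows "cut_slope P h t i \<bullet> d = (\<Sum>w\<in>realizations P (Suc t). trans_prob P t i w * (h w \<bullet> d))"
proof -
  let ?n = "nrow P (Suc t)"
  have "cut_slope P h t i \<bullet> d =
      (\<Sum>r<?n. \<Sum>w\<in>realizations P (Suc t). trans_prob P t i w * (h w $ r) * d $ r)"
    using assms(1) by (simp add: cut_slope_def scalar_prod_def lessThan_atLeast0 sum_distrib_right)
  also have "\<dots> = (\<Sum>w\<in>realizations P (Suc t). \<Sum>r<?n. trans_prob P t i w * (h w $ r) * d $ r)"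
    by (rule sum.swap)
  also have "\<dots> = (\<Sum>w\<in>realizations P (Suc t). trans_prob P t i w * (h w \<bullet> d))"
    using assms(1) by (simp add: scalar_prod_def lessThan_atLeast0 sum_distrib_left mult.assoc)
  finally show ?thesis .
qed

text \<open>Both sides use the approximations of iteration \<open>k\<close>, whereas the state is
  the one that iteration \<open>k + 1\<close> would reach along \<open>\<omega>\<close>. Hence the
  condition is settled before scenario \<open>k + 1\<close> is drawn. Along a path of the method the
  reverse strict inequality never occurs (\<open>V_le_bellman\<close>), so a gap is exactly a
  failure of the Bellman equation.\<close>

definition bellman_gap ::
    "('w, 'i) mslp \<Rightarrow> 'w selection \<Rightarrow> (nat \<Rightarrow> nat \<Rightarrow> 'w) \<Rightarrow> (nat \<Rightarrow> nat \<Rightarrow> 'w \<Rightarrow> real vec) \<Rightarrow>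
      nat \<Rightarrow> (nat \<Rightarrow> 'w) \<Rightarrow> bool" where
  "bellman_gap P sel \<xi> g k \<omega> \<longleftrightarrow> (\<exists>t<horizon P.
     let R = matB P t (\<omega> t) *\<^sub>v decision sel \<xi> g (Suc k) \<omega> t; i = info P t (\<omega> t) in
     approx P sel \<xi> g k t R i < expected_stage_value P (approx P sel \<xi> g k (Suc t)) t R i)"

text \<open>One realized path of the method. Everything in this locale is deterministic, and
  constants found here may depend on the path.\<close>

locale regularized_path =
  fixes P :: "('w, 'i) mslp"
    and Q :: "nat \<Rightarrow> real mat"
    and \<rho> :: "nat \<Rightarrow> real"
    and sel :: "'w selection"
    and \<xi> :: "nat \<Rightarrow> nat \<Rightarrow> 'w"
    and g :: "nat \<Rightarrow> nat \<Rightarrow> 'w \<Rightarrow> real vec"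
  assumes data: "mslp_data P"
    and markov: "markov_process P"
    and Q_psd: "\<And>t. t \<le> horizon P \<Longrightarrow> psd (nrow P (Suc t)) (Q t)"
    and forward: "forward_passes P Q \<rho> sel \<xi> g"
    and backward: "backward_passes P sel \<xi> g"
    and dual_basic: "dual_basic_solutions_used P sel \<xi> g"
    and \<rho>_nonneg: "\<And>k. 0 \<le> \<rho> k"
    and \<rho>_lim: "\<rho> \<longlonglongrightarrow> 0"
    and bounded: "bounded_feasible_sets P"
begin

abbreviation "V \<equiv> approx P sel \<xi> g"
abbreviation "X \<equiv> decision sel \<xi> g"
abbreviation "Rt \<equiv> trial P sel \<xi> g"
abbreviation "states t \<equiv> carrier_vec (nrow P (Suc t)) :: real vec set"

lemma realization:
  assumes "\<omega> \<in> scenarios P" "t \<le> horizon P"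
  shows "\<omega> t \<in> realizations P t"
proof -
  have "\<omega> \<in> (\<Pi>\<^sub>E t\<in>{0..horizon P}. realizations P t)"
    using data assms(1) unfolding mslp_data_def by blast
  then show ?thesis using assms(2) by (intro PiE_mem[of \<omega> "{0..horizon P}"]) auto
qed

lemma finite_realizations: "t \<le> horizon P \<Longrightarrow> finite (realizations P t)"
  using data unfolding mslp_data_def by blast

lemma data_dims:
  assumes "t \<le> horizon P" "w \<in> realizations P t"
  shows "matA P t w \<in> carrier_mat (nrow P t) (nvar P t)"
    "matB P t w \<in> carrier_mat (nrow P (Suc t)) (nvar P t)"
    "rhs P t w \<in> carrier_vec (nrow P t)" "cost P t w \<in> carrier_vec (nvar P t)"
  using data assms unfolding mslp_data_def by blast+

lemma sampled_scenario: "\<xi> k \<in> scenarios P"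
  using forward unfolding forward_passes_def by blast

lemma decision_arg_min:
  assumes "\<omega> \<in> scenarios P" "t \<le> horizon P"
  shows "is_arg_min (forward_objective P Q \<rho> sel \<xi> g k t (\<omega> t))
    (\<lambda>x. x \<in> feasible P t (incoming P \<omega> (X k \<omega>) t) (\<omega> t)) (X k \<omega> t)"
  using forward assms unfolding forward_passes_def by blast

lemma decision_feasible:
  assumes "\<omega> \<in> scenarios P" "t \<le> horizon P"
  shows "X k \<omega> t \<in> feasible P t (incoming P \<omega> (X k \<omega>) t) (\<omega> t)"
  using decision_arg_min[OF assms] unfolding is_arg_min_def by blast

lemma post_state: "t \<le> horizon P \<Longrightarrow> w \<in> realizations P t \<Longrightarrow> matB P t w *\<^sub>v x \<in> states t"
  using data_dims(2)[of t w] by (auto intro!: carrier_vecI)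

lemma incoming_carrier:
  assumes "\<omega> \<in> scenarios P" "t \<le> horizon P"
  shows "incoming P \<omega> x t \<in> carrier_vec (nrow P t)"
  using assms post_state[OF _ realization] by (cases t) (auto simp: incoming_def)

lemma trial_state: "t \<le> horizon P \<Longrightarrow> Rt k t \<in> states t"
  unfolding trial_def using post_state realization sampled_scenario by blast

lemma subgradient:
  assumes "t < horizon P" "w \<in> realizations P (Suc t)"
  shows "g k (Suc t) w \<in> carrier_vec (nrow P (Suc t))"
    "\<bar>stage_value P (V k (Suc t)) (Suc t) (Rt k t) w\<bar> \<noteq> \<infinity>"
    "R \<in> states t \<Longrightarrow> stage_value P (V k (Suc t)) (Suc t) (Rt k t) w + ereal (g k (Suc t) w \<bullet> (R - Rt k t))
      \<le> stage_value P (V k (Suc t)) (Suc t) R w"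
proof -
  have "g k (Suc t) w \<in> subdifferential (nrow P (Suc t))
      (\<lambda>R. stage_value P (V k (Suc t)) (Suc t) R w) (Rt k t)"
    using backward assms unfolding backward_passes_def by fastforce
  then show "g k (Suc t) w \<in> carrier_vec (nrow P (Suc t))"
    "\<bar>stage_value P (V k (Suc t)) (Suc t) (Rt k t) w\<bar> \<noteq> \<infinity>"
    "R \<in> states t \<Longrightarrow> stage_value P (V k (Suc t)) (Suc t) (Rt k t) w + ereal (g k (Suc t) w \<bullet> (R - Rt k t))
      \<le> stage_value P (V k (Suc t)) (Suc t) R w"
    unfolding subdifferential_def by auto
qed

section \<open>The approximations as maxima of affine cuts\<close>

definition trial_value :: "nat \<Rightarrow> nat \<Rightarrow> 'w \<Rightarrow> real" where
  "trial_value k t w = real_of_ereal (stage_value P (V k (Suc t)) (Suc t) (Rt k t) w)"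

text \<open>\<open>subdifferential\<close> has elements only where the function is finite, so the
  mere existence of the chosen subgradients makes the stage values at trial points real
  numbers.\<close>

lemma stage_value_trial:
  assumes "t < horizon P" "w \<in> realizations P (Suc t)"
  shows "stage_value P (V k (Suc t)) (Suc t) (Rt k t) w = ereal (trial_value k t w)"
  using subgradient(2)[OF assms] by (simp add: trial_value_def ereal_real')

definition new_cut :: "nat \<Rightarrow> nat \<Rightarrow> real vec \<Rightarrow> 'i \<Rightarrow> ereal" where
  "new_cut k t = cut P (V k (Suc t)) (Rt k t) (g k (Suc t)) t"

lemma V_horizon: "horizon P \<le> t \<Longrightarrow> V k t = Vstar P t"
  unfolding approx_def by (subst Vbar.simps) simp

lemma V_0: "t < horizon P \<Longrightarrow> V 0 t R i = new_cut 0 t R i"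
  unfolding approx_def new_cut_def by (subst Vbar.simps) simp

lemma V_Suc: "t < horizon P \<Longrightarrow> V (Suc k) t R i = max (V k t R i) (new_cut (Suc k) t R i)"
  unfolding approx_def new_cut_def by (subst Vbar.simps) simp

lemma expected_stage_value_trial:
  assumes "t < horizon P"
  shows "expected_stage_value P (V k (Suc t)) t (Rt k t) i =
    ereal (\<Sum>w\<in>realizations P (Suc t). trans_prob P t i w * trial_value k t w)"
  unfolding expected_stage_value_def using stage_value_trial[OF assms] by simp

lemma new_cut_sum:
  assumes "t < horizon P" "R \<in> states t"
  shows "new_cut k t R i = ereal (\<Sum>w\<in>realizations P (Suc t).
    trans_prob P t i w * (trial_value k t w + g k (Suc t) w \<bullet> (R - Rt k t)))"
proof -
  have "R - Rt k t \<in> states t" using assms trial_state[of t k] by simp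
  then show ?thesis
    unfolding new_cut_def cut_def expected_stage_value_trial[OF assms(1)]
    by (subst cut_slope_scalar_prod)
      (auto simp: subgradient(1)[OF assms(1)] distrib_left sum.distrib)
qed

definition intercept :: "nat \<Rightarrow> nat \<Rightarrow> 'i \<Rightarrow> real" where
  "intercept k t i = (\<Sum>w\<in>realizations P (Suc t). trans_prob P t i w * trial_value k t w)
    - cut_slope P (g k (Suc t)) t i \<bullet> Rt k t"

lemma new_cut_affine:
  assumes "t < horizon P" "R \<in> states t"
  shows "new_cut k t R i = ereal (intercept k t i + cut_slope P (g k (Suc t)) t i \<bullet> R)"
proof -
  have "cut_slope P (g k (Suc t)) t i \<bullet> (R - Rt k t) =
      cut_slope P (g k (Suc t)) t i \<bullet> R - cut_slope P (g k (Suc t)) t i \<bullet> Rt k t"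
    using assms trial_state[of t k] by (intro scalar_prod_minus_distrib) auto
  then show ?thesis
    unfolding new_cut_def cut_def expected_stage_value_trial[OF assms(1)] intercept_def by simp
qed

lemma V_eq_Max:
  assumes "t < horizon P" "R \<in> states t"
  shows "V k t R i = ereal (Max ((\<lambda>j. intercept j t i + cut_slope P (g j (Suc t)) t i \<bullet> R) ` {..k}))"
proof (induction k)
  case 0
  show ?case using assms by (simp add: V_0 new_cut_affine)
next
  case (Suc k)
  then show ?case
    using assms by (simp add: V_Suc new_cut_affine atMost_Suc max.commute)
qed

section \<open>Monotonicity and Bellman inequalities\<close>

lemma V_mono: "j \<le> k \<Longrightarrow> V j t R i \<le> V k t R i"
proof (cases "t < horizon P")
  case True
  show "j \<le> k \<Longrightarrow> V j t R i \<le> V k t R i"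
    by (rule lift_Suc_mono_le[of "\<lambda>k. V k t R i"]) (auto simp: V_Suc True)
qed (simp add: V_horizon)

lemma new_cut_le_V: "t < horizon P \<Longrightarrow> new_cut k t R i \<le> V k t R i"
  by (cases k) (auto simp: V_0 V_Suc)

lemma new_cut_le_bellman:
  assumes "t < horizon P" "R \<in> states t"
  shows "new_cut k t R i \<le> expected_stage_value P (V k (Suc t)) t R i"
proof -
  have "ereal (trans_prob P t i w * (trial_value k t w + g k (Suc t) w \<bullet> (R - Rt k t)))
      \<le> ereal (trans_prob P t i w) * stage_value P (V k (Suc t)) (Suc t) R w"
    if "w \<in> realizations P (Suc t)" for w
    using subgradient(3)[OF assms(1) that assms(2), of k] trans_prob_nonneg[of P t i w]
    unfolding stage_value_trial[OF assms(1) that] times_ereal.simps(1)[symmetric]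
    by (intro ereal_mult_left_mono) auto
  then show ?thesis
    unfolding new_cut_sum[OF assms] expected_stage_value_def sum_ereal[symmetric]
    by (intro sum_mono)
qed

text \<open>The newest cut lies below the Bellman update by the averaged subgradient inequality; an
  older cut lies below the update of its own iteration, which can only have grown since.\<close>

lemma V_le_bellman:
  assumes "t < horizon P" "R \<in> states t"
  shows "V k t R i \<le> expected_stage_value P (V k (Suc t)) t R i"
proof (induction k)
  case 0
  show ?case using new_cut_le_bellman[OF assms] by (simp add: V_0 assms)
next
  case (Suc k)
  have "expected_stage_value P (V k (Suc t)) t R i \<le> expected_stage_value P (V (Suc k) (Suc t)) t R i"
    by (intro expected_stage_value_mono stage_value_mono V_mono) simp
  with Suc have "V k t R i \<le> expected_stage_value P (V (Suc k) (Suc t)) t R i"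
    by (rule order_trans)
  then show ?case using new_cut_le_bellman[OF assms, of "Suc k" i] by (simp add: V_Suc assms)
qed

text \<open>At its own trial point the linear part of a cut vanishes and the cut equals the Bellman
  update. Together with \<open>V_le_bellman\<close>, a sampled state satisfies the Bellman equation
  right after the backward pass.\<close>

lemma bellman_le_V_trial:
  assumes "t < horizon P"
  shows "expected_stage_value P (V k (Suc t)) t (Rt k t) i \<le> V k t (Rt k t) i"
proof -
  have "Rt k t \<in> states t" using assms trial_state[of t k] by simp
  then have "new_cut k t (Rt k t) i = expected_stage_value P (V k (Suc t)) t (Rt k t) i"
    unfolding new_cut_def cut_def by simp
  then show ?thesis using new_cut_le_V[OF assms] by metis
qed

lemma V_le_Vstar: "t \<le> horizon P \<Longrightarrow> R \<in> states t \<Longrightarrow> V k t R i \<le> Vstar P t R i"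
proof (induction "horizon P - t" arbitrary: t R i)
  case 0
  then show ?case by (simp add: V_horizon)
next
  case (Suc n)
  then have t: "t < horizon P" by simp
  have "V k t R i \<le> expected_stage_value P (V k (Suc t)) t R i"
    using V_le_bellman t Suc.prems by blast
  also have "\<dots> \<le> expected_stage_value P (Vstar P (Suc t)) t R i"
    using t Suc.hyps by (intro expected_stage_value_mono stage_value_mono Suc.hyps(1)) (auto intro: post_state)
  also have "\<dots> = Vstar P t R i" using t by (subst (2) Vstar.simps) simp
  finally show ?case .
qed

section \<open>Finiteness of the cuts and stabilization\<close>

lemma finite_slope_choices:
  assumes "t < horizon P" "\<And>w. w \<in> realizations P (Suc t) \<Longrightarrow> finite (range (\<lambda>k. g k (Suc t) w))"
  shows "finite (range (\<lambda>k. restrict (g k (Suc t)) (realizations P (Suc t))))"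
proof (rule finite_subset)
  show "range (\<lambda>k. restrict (g k (Suc t)) (realizations P (Suc t))) \<subseteq>
      (\<Pi>\<^sub>E w\<in>realizations P (Suc t). range (\<lambda>k. g k (Suc t) w))"
    by auto
  show "finite (\<Pi>\<^sub>E w\<in>realizations P (Suc t). range (\<lambda>k. g k (Suc t) w))"
    using assms finite_realizations by (intro finite_PiE) auto
qed

text \<open>Trial point and cut intercepts enter the dual only through its objective. Its basic
  feasible solutions depend on the iteration only through the columns of the cut matrix, which the
  induction hypothesis for the next stage confines to a finite set.\<close>

lemma finite_subgradients:
  assumes "1 \<le> t" "t \<le> horizon P" "w \<in> realizations P t"
  shows "finite (range (\<lambda>k. g k t w))"
  using assms
proof (induction "horizon P - t" arbitrary: t w rule: less_induct)
  case less
  define i where "i = info P t w"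
  \<comment> \<open>The last stage has no cuts; there the empty \<open>C\<close> starts the
    induction.\<close>
  define C where "C = (if t < horizon P then range (\<lambda>j. cut_slope P (g j (Suc t)) t i) else {})"
  have "finite C"
  proof (cases "t < horizon P")
    case True
    have "finite (range (\<lambda>k. g k (Suc t) w))" if "w \<in> realizations P (Suc t)" for w
      using less.hyps[of "Suc t" w] that True by simp
    from finite_slope_choices[OF True this]
    have "finite ((\<lambda>h. cut_slope P h t i) ` range (\<lambda>k. restrict (g k (Suc t)) (realizations P (Suc t))))"
      by (rule finite_imageI)
    moreover have "C \<subseteq> (\<lambda>h. cut_slope P h t i) ` range (\<lambda>k. restrict (g k (Suc t)) (realizations P (Suc t)))"
    proof
      fix s assume "s \<in> C"
      then obtain j where "s = cut_slope P (g j (Suc t)) t i" using True by (auto simp: C_def)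
      also have "\<dots> = cut_slope P (restrict (g j (Suc t)) (realizations P (Suc t))) t i"
        by (rule cut_slope_cong) simp
      finally show "s \<in> (\<lambda>h. cut_slope P h t i) ` range (\<lambda>k. restrict (g k (Suc t)) (realizations P (Suc t)))"
        by blast
    qed
    ultimately show ?thesis by (rule finite_subset[rotated])
  qed (simp add: C_def)
  let ?Pi = "{\<pi>. \<exists>G \<mu> s. dim_row G = nrow P (Suc t) \<and> set (cols G) \<subseteq> C \<and>
    dual_feasible (matA P t w) (matB P t w) G (cost P t w) (\<pi>, \<mu>, s) \<and>
    dual_basic (matA P t w) (matB P t w) G (\<pi>, \<mu>, s)}"
  have "finite ?Pi"
    using \<open>finite C\<close> data_dims[OF less.prems(2,3)] by (intro finite_basic_dual_multipliers) auto
  moreover have "g k t w \<in> uminus ` ?Pi" for k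
  proof -
    let ?G = "cut_slopes P g k t i"
    obtain \<pi> \<mu> s where *: "dual_basic_optimal (matA P t w) (matB P t w) ?G (cost P t w)
        (rhs P t w - Rt k (t - 1)) (cut_intercepts P Rt g k t i) (\<pi>, \<mu>, s)" "g k t w = - \<pi>"
      using dual_basic less.prems unfolding dual_basic_solutions_used_def i_def by fastforce
    have "dim_row ?G = nrow P (Suc t)"
      by (simp add: cut_slopes_def)
    moreover have "set (cols ?G) \<subseteq> C"
    proof -
      have "set (if t < horizon P then map (\<lambda>j. cut_slope P (g j (Suc t)) t i) [0..<Suc k] else []) \<subseteq>
          carrier_vec (nrow P (Suc t))"
        by auto
      then show ?thesis unfolding cut_slopes_def cols_mat_of_cols C_def by auto
    qed
    moreover have "dual_feasible (matA P t w) (matB P t w) ?G (cost P t w) (\<pi>, \<mu>, s)"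
      "dual_basic (matA P t w) (matB P t w) ?G (\<pi>, \<mu>, s)"
      using *(1) unfolding dual_basic_optimal_def is_arg_max_def by blast+
    ultimately have "\<pi> \<in> ?Pi" by blast
    then show ?thesis using *(2) by blast
  qed
  ultimately show ?case
    by (intro finite_subset[of "range (\<lambda>k. g k t w)" "uminus ` ?Pi"]) auto
qed

text \<open>The constant term of a cut is minus the conjugate of the stage value at the slope, so it does not
  depend on the trial point.\<close>

lemma new_cut_cong:
  assumes t: "t < horizon P" and R: "R \<in> states t"
    and sv: "\<And>R w. R \<in> states t \<Longrightarrow> w \<in> realizations P (Suc t) \<Longrightarrow>
      stage_value P (V k (Suc t)) (Suc t) R w = stage_value P (V l (Suc t)) (Suc t) R w"
    and g: "\<And>w. w \<in> realizations P (Suc t) \<Longrightarrow> g k (Suc t) w = g l (Suc t) w"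
  shows "new_cut k t R i = new_cut l t R i"
proof -
  have "trial_value k t w + g k (Suc t) w \<bullet> (R - Rt k t) = trial_value l t w + g l (Suc t) w \<bullet> (R - Rt l t)"
    if w: "w \<in> realizations P (Suc t)" for w
  proof -
    have tr: "Rt j t \<in> states t" for j using trial_state t by simp
    have gc: "g l (Suc t) w \<in> states t" using subgradient(1)[OF t w] .
    \<comment> \<open>When functions and slopes agree, the subgradient inequality at each trial
      point, tested at the other one, gives the two inequalities that make the constant terms
      equal.\<close>
    have le: "trial_value j t w + g j (Suc t) w \<bullet> (Rt j' t - Rt j t) \<le> trial_value j' t w"
      if "stage_value P (V j (Suc t)) (Suc t) (Rt j' t) w = stage_value P (V j' (Suc t)) (Suc t) (Rt j' t) w"
      for j j'
      using subgradient(3)[OF t w tr, of j j'] that by (simp add: stage_value_trial[OF t w])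
    have "trial_value k t w + g l (Suc t) w \<bullet> (Rt l t - Rt k t) \<le> trial_value l t w"
      "trial_value l t w + g l (Suc t) w \<bullet> (Rt k t - Rt l t) \<le> trial_value k t w"
      using le[of k l] le[of l k] sv[OF tr w] g[OF w] by metis+
    then show ?thesis
      unfolding g[OF w] using R tr[of k] tr[of l] gc
      by (simp add: scalar_prod_minus_distrib[of _ "nrow P (Suc t)"])
  qed
  then show ?thesis unfolding new_cut_sum[OF t R] by (auto intro!: sum.cong)
qed

text \<open>A cut is determined by its slope only relative to the function it supports, so
  stabilization has to proceed backwards: once stage \<open>t + 1\<close> is frozen, a repeated
  choice of subgradients repeats a cut that the maximum already contains.\<close>

lemma V_eventually_constant:
  "\<exists>K. \<forall>k\<ge>K. \<forall>R\<in>states t. \<forall>i. V k t R i = V K t R i"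
proof (induction "horizon P - t" arbitrary: t)
  case 0
  then show ?case by (auto simp: V_horizon)
next
  case (Suc n)
  then have t: "t < horizon P" by simp
  have "n = horizon P - Suc t" using Suc.hyps(2) by simp
  from Suc.hyps(1)[OF this] obtain K
    where K: "\<And>k R i. K \<le> k \<Longrightarrow> R \<in> states (Suc t) \<Longrightarrow> V k (Suc t) R i = V K (Suc t) R i"
    by blast
  have sv: "stage_value P (V k (Suc t)) (Suc t) R w = stage_value P (V l (Suc t)) (Suc t) R w"
    if "K \<le> k" "K \<le> l" "w \<in> realizations P (Suc t)" for k l R w
  proof -
    have "V k (Suc t) (matB P (Suc t) w *\<^sub>v x) i = V l (Suc t) (matB P (Suc t) w *\<^sub>v x) i" for x i
      using K[OF that(1)] K[OF that(2)] post_state[of "Suc t" w x] that(3) t by simp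
    then show ?thesis by (intro antisym stage_value_mono) simp_all
  qed
  define key where "key k = restrict (g k (Suc t)) (realizations P (Suc t))" for k
  have "finite (range key)"
    unfolding key_def using finite_slope_choices[OF t] finite_subgradients t by simp
  then have "finite (key ` {K..})" by (rule finite_subset[rotated]) auto
  \<comment> \<open>Representatives are taken from index \<open>K\<close> on: cuts with the same
    subgradients but made before stage \<open>t + 1\<close> froze may have other intercepts.\<close>
  then obtain C where C: "C \<subseteq> {K..}" "finite C" "key ` {K..} = key ` C"
    using finite_subset_image[of "key ` {K..}" key "{K..}"] by blast
  define K' where "K' = Max (insert K C)"
  have K': "K \<le> K'" "\<And>l. l \<in> C \<Longrightarrow> l \<le> K'" using C(2) by (auto simp: K'_def)
  have step: "V (Suc k) t R i = V k t R i" if k: "K' \<le> k" and R: "R \<in> states t" for k R i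
  proof -
    have "key (Suc k) \<in> key ` C" using C(3) k K' by (metis atLeast_iff image_eqI le_SucI order_trans)
    then obtain l where l: "l \<in> C" "key (Suc k) = key l" by blast
    have "g (Suc k) (Suc t) w = g l (Suc t) w" if "w \<in> realizations P (Suc t)" for w
      using fun_cong[OF l(2), of w] that by (simp add: key_def)
    then have "new_cut (Suc k) t R i = new_cut l t R i"
      using l C(1) k K' by (intro new_cut_cong t R sv) auto
    also have "\<dots> \<le> V l t R i" using new_cut_le_V t by blast
    also have "\<dots> \<le> V k t R i" using K'(2)[OF l(1)] k by (intro V_mono) simp
    finally show ?thesis using t by (simp add: V_Suc max_absorb1)
  qed
  have "V k t R i = V K' t R i" if "K' \<le> k" "R \<in> states t" for k R i
    using that(1) by (induction k rule: dec_induct) (auto simp: step that(2))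
  then show ?case by blast
qed

text \<open>If the sampled scenario carries a gap, its state becomes a trial point of iteration
  \<open>k + 1\<close>. There the new approximation reaches the new Bellman update, which is at
  least the old one and thus exceeds the old approximation. So the approximation changes, which
  happens only finitely often.\<close>

lemma finite_sampled_bellman_gaps: "finite {k. bellman_gap P sel \<xi> g k (\<xi> (Suc k))}"
proof -
  obtain K where K: "\<And>t k R i. K t \<le> k \<Longrightarrow> R \<in> states t \<Longrightarrow> V k t R i = V (K t) t R i"
    using V_eventually_constant by metis
  define N where "N = Max (K ` {..horizon P})"
  have N: "K t \<le> N" if "t \<le> horizon P" for t using that by (auto simp: N_def)
  have "\<not> bellman_gap P sel \<xi> g k (\<xi> (Suc k))" if k: "N \<le> k" for k
  proof
    assume "bellman_gap P sel \<xi> g k (\<xi> (Suc k))"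
    then obtain t i where t: "t < horizon P" and
      gap: "V k t (Rt (Suc k) t) i < expected_stage_value P (V k (Suc t)) t (Rt (Suc k) t) i"
      unfolding bellman_gap_def Let_def trial_def by blast
    have "Rt (Suc k) t \<in> states t" using trial_state t by simp
    then have "V (Suc k) t (Rt (Suc k) t) i = V k t (Rt (Suc k) t) i"
      using K[of t k] K[of t "Suc k"] N[of t] k t by simp
    moreover have "expected_stage_value P (V k (Suc t)) t (Rt (Suc k) t) i
        \<le> expected_stage_value P (V (Suc k) (Suc t)) t (Rt (Suc k) t) i"
      by (intro expected_stage_value_mono stage_value_mono V_mono) simp
    ultimately show False
      using gap bellman_le_V_trial[OF t, of "Suc k" i] by simp
  qed
  then have "{k. bellman_gap P sel \<xi> g k (\<xi> (Suc k))} \<subseteq> {..<N}" by (auto simp: not_le[symmetric])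
  then show ?thesis by (rule finite_subset) simp
qed

section \<open>Uniform bounds and exactness of late forward decisions\<close>

definition decisions :: "nat \<Rightarrow> real vec set" where
  "decisions t = {X k \<omega> t | k \<omega>. \<omega> \<in> scenarios P}"

lemma decisions_carrier: "t \<le> horizon P \<Longrightarrow> decisions t \<subseteq> carrier_vec (nvar P t)"
  using decision_feasible unfolding decisions_def feasible_def by blast

lemma bounded_post_states:
  assumes "t \<le> horizon P" "bounded_vecs (decisions t)"
  shows "bounded_vecs (\<Union>w\<in>realizations P t. (\<lambda>x. matB P t w *\<^sub>v x) ` decisions t)"
  using assms
  by (intro bounded_vecs_UN_finite finite_realizations bounded_vecs_mult_mat[OF _ data_dims(2)]
      decisions_carrier)

text \<open>The hypothesis bounds one feasible set at a time, while infinitely many resource states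
  may occur. Going forward through the stages, bounded decisions give bounded states, and
  \<open>bounded_vecs_polyhedra\<close> turns these into a common bound for the next
  decisions.\<close>

lemma bounded_decisions: "t \<le> horizon P \<Longrightarrow> bounded_vecs (decisions t)"
proof (induction t)
  case 0
  have "decisions 0 \<subseteq> (\<Union>w\<in>realizations P 0. feasible P 0 (0\<^sub>v (nrow P 0)) w)"
    using decision_feasible[of _ 0] realization[of _ 0] by (fastforce simp: decisions_def incoming_def)
  moreover have "bounded_vecs (\<Union>w\<in>realizations P 0. feasible P 0 (0\<^sub>v (nrow P 0)) w)"
    using bounded finite_realizations[of 0] unfolding bounded_feasible_sets_def
    by (intro bounded_vecs_UN_finite) auto
  ultimately show ?case by (rule bounded_vecs_subset[rotated])
next
  case (Suc t)
  define RS where "RS = (\<Union>w\<in>realizations P t. (\<lambda>x. matB P t w *\<^sub>v x) ` decisions t)"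
  have RS: "bounded_vecs RS" "RS \<subseteq> states t"
    using bounded_post_states Suc post_state by (auto simp: RS_def)
  have "decisions (Suc t) \<subseteq> (\<Union>w\<in>realizations P (Suc t). \<Union>R\<in>RS. feasible P (Suc t) R w)"
  proof
    fix x assume "x \<in> decisions (Suc t)"
    then obtain k \<omega> where \<omega>: "\<omega> \<in> scenarios P" "x = X k \<omega> (Suc t)" by (auto simp: decisions_def)
    have "incoming P \<omega> (X k \<omega>) (Suc t) \<in> RS"
      using \<omega>(1) realization[OF \<omega>(1), of t] Suc.prems by (auto simp: RS_def incoming_def decisions_def)
    then show "x \<in> (\<Union>w\<in>realizations P (Suc t). \<Union>R\<in>RS. feasible P (Suc t) R w)"
      using decision_feasible[OF \<omega>(1) Suc.prems, of k] realization[OF \<omega>(1) Suc.prems] \<omega>(2) by blast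
  qed
  moreover have "bounded_vecs (\<Union>w\<in>realizations P (Suc t). \<Union>R\<in>RS. feasible P (Suc t) R w)"
  proof (rule bounded_vecs_UN_finite)
    fix w assume w: "w \<in> realizations P (Suc t)"
    have "bounded_vecs (feasible P (Suc t) R w)" if "R \<in> RS" for R
      using bounded w that RS(2) Suc.prems unfolding bounded_feasible_sets_def by auto
    then show "bounded_vecs (\<Union>R\<in>RS. feasible P (Suc t) R w)"
      unfolding feasible_def
      using data_dims[OF Suc.prems w] RS by (intro bounded_vecs_polyhedra) auto
  qed (use finite_realizations Suc.prems in blast)
  ultimately show ?case by (rule bounded_vecs_subset[rotated])
qed

text \<open>After stabilization the maximum runs over the fixed index set \<open>{..K}\<close>, so a
  single threshold from \<open>regularized_minimizer_exact\<close> serves all later iterations, and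
  the penalties eventually fall below it.\<close>

lemma forward_decisions_exact_stage:
  assumes t: "t < horizon P" and w: "w \<in> realizations P t"
  shows "\<exists>K. \<forall>k\<ge>K. \<forall>\<omega>\<in>scenarios P. \<omega> t = w \<longrightarrow>
    stage_value P (V k t) t (incoming P \<omega> (X (Suc k) \<omega>) t) w =
    ereal (cost P t w \<bullet> X (Suc k) \<omega> t) + V k t (matB P t w *\<^sub>v X (Suc k) \<omega> t) (info P t w)"
proof -
  define A B c i where "A = matA P t w" and "B = matB P t w" and "c = cost P t w" and "i = info P t w"
  define m n p where "m = nrow P t" and "n = nvar P t" and "p = nrow P (Suc t)"
  have t': "t \<le> horizon P" using t by simp
  have A: "A \<in> carrier_mat m n" and B: "B \<in> carrier_mat p n" and c: "c \<in> carrier_vec n"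
    using data_dims[OF t' w] by (simp_all add: A_def B_def c_def m_def n_def p_def)
  have Q: "Q t \<in> carrier_mat p p" "transpose_mat (Q t) = Q t"
    using Q_psd[OF t'] by (auto simp: psd_def p_def)
  obtain K where K: "\<And>k R i. K \<le> k \<Longrightarrow> R \<in> states t \<Longrightarrow> V k t R i = V K t R i"
    using V_eventually_constant[of t] by blast
  define s where "s j = cut_slope P (g j (Suc t)) t i" for j
  have s: "s j \<in> carrier_vec p" for j by (simp add: s_def p_def)
  \<comment> \<open>Slope of the \<open>j\<close>-th piece as a function of the decision: the cost
    plus the cut slope pulled back through \<open>B\<close>.\<close>
  define l where "l j = c + transpose_mat B *\<^sub>v s j" for j
  have l: "l j \<in> carrier_vec n" for j using c B s by (simp add: l_def)
  define f where "f x = Max ((\<lambda>j. intercept j t i + l j \<bullet> x) ` {..K})" for x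
  have obj: "ereal (c \<bullet> x) + V k t (B *\<^sub>v x) i = ereal (f x)" if "K \<le> k" "x \<in> carrier_vec n" for k x
  proof -
    have "l j \<bullet> x = c \<bullet> x + s j \<bullet> (B *\<^sub>v x)" for j
      using c B s[of j] that(2) transpose_vec_mult_scalar[of B p n x "s j"]
      by (simp add: l_def add_scalar_prod_distrib[of _ n])
    then have "f x = Max ((\<lambda>j. (intercept j t i + s j \<bullet> (B *\<^sub>v x)) + c \<bullet> x) ` {..K})"
      by (simp add: f_def algebra_simps)
    also have "\<dots> = Max ((\<lambda>j. intercept j t i + s j \<bullet> (B *\<^sub>v x)) ` {..K}) + c \<bullet> x"
      by (rule Max_add_commute) auto
    finally have *: "f x = \<dots>" .
    have "B *\<^sub>v x \<in> states t" using post_state[OF t' w] by (simp add: B_def)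
    then have "V k t (B *\<^sub>v x) i = ereal (Max ((\<lambda>j. intercept j t i + s j \<bullet> (B *\<^sub>v x)) ` {..K}))"
      using K[OF that(1)] V_eq_Max[OF t] by (simp add: s_def)
    then show ?thesis unfolding * by simp
  qed
  define RS where "RS = (\<Union>w\<in>realizations P t. (\<lambda>x. matB P t w *\<^sub>v x) ` decisions t)"
  have RS: "bounded_vecs RS" "RS \<subseteq> carrier_vec p"
    using bounded_post_states[OF t' bounded_decisions[OF t']] post_state[OF t'] by (auto simp: RS_def p_def)
  \<comment> \<open>Contains every deviation from an incumbent, since both the current state and the
    incumbent are post-decision states of some iteration.\<close>
  define U where "U = (\<lambda>(x, y). x - y) ` (RS \<times> RS)"
  have U: "U \<subseteq> carrier_vec p" "bounded_vecs U"
  proof -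
    show "U \<subseteq> carrier_vec p"
    proof
      fix u assume "u \<in> U"
      then obtain a b where "a \<in> RS" "b \<in> RS" "u = a - b" by (auto simp: U_def)
      then show "u \<in> carrier_vec p" using subsetD[OF RS(2), of a] subsetD[OF RS(2), of b] by simp
    qed
    show "bounded_vecs U" unfolding U_def using RS by (intro bounded_vecs_diff)
  qed
  have ne: "{..K} \<noteq> {}" by auto
  show ?thesis
  proof (rule regularized_minimizer_exact[where l = l, OF A B Q finite_atMost ne l U], goal_cases)
    case (1 \<rho>0)
    have "\<forall>\<^sub>F k in sequentially. \<rho> k < \<rho>0" using \<rho>_lim 1(1) by (rule order_tendstoD)
    then obtain K2 where K2: "\<And>k. K2 \<le> k \<Longrightarrow> \<rho> k < \<rho>0" unfolding eventually_sequentially by blast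
    have "stage_value P (V k t) t (incoming P \<omega> (X (Suc k) \<omega>) t) w =
        ereal (c \<bullet> X (Suc k) \<omega> t) + V k t (B *\<^sub>v X (Suc k) \<omega> t) i"
      if k: "max K K2 \<le> k" and \<omega>: "\<omega> \<in> scenarios P" "\<omega> t = w" for k \<omega>
    proof -
      \<comment> \<open>\<open>V k\<close> drives the forward pass of iteration
        \<open>Suc k\<close>, whose penalty is \<open>\<rho> (Suc k)\<close> and whose incumbent is
        the trial point of iteration \<open>k\<close>.\<close>
      define x R r where "x = X (Suc k) \<omega> t" and "R = incoming P \<omega> (X (Suc k) \<omega>) t" and "r = Rt k t"
      have kK: "K \<le> k" using k by simp
      have feas: "feasible P t R w = {x \<in> carrier_vec n. 0\<^sub>v n \<le> x \<and> R + A *\<^sub>v x = rhs P t w}"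
        by (simp add: feasible_def A_def n_def)
      have R: "R \<in> carrier_vec m" using incoming_carrier[OF \<omega>(1) t'] by (simp add: R_def m_def)
      have xf: "x \<in> feasible P t R w" using decision_feasible[OF \<omega>(1) t'] \<omega>(2) by (simp add: x_def R_def)
      then have x: "x \<in> carrier_vec n" "0\<^sub>v n \<le> x" "R + A *\<^sub>v x = rhs P t w" by (auto simp: feas)
      have r: "r \<in> carrier_vec p" using trial_state[OF t'] by (simp add: r_def p_def)
      have "x \<in> decisions t" using \<omega> by (auto simp: x_def decisions_def)
      then have "B *\<^sub>v x \<in> RS" using w by (auto simp: RS_def B_def)
      moreover have "r \<in> RS"
        using realization[OF sampled_scenario t', of k] sampled_scenario[of k]
        by (auto simp: RS_def r_def trial_def decisions_def)
      ultimately have Bxr: "B *\<^sub>v x - r \<in> U" by (auto simp: U_def)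
      define q where "q x = \<rho> (Suc k) / 2 * ((B *\<^sub>v x - r) \<bullet> (Q t *\<^sub>v (B *\<^sub>v x - r)))" for x
      have fobj: "forward_objective P Q \<rho> sel \<xi> g (Suc k) t w x = ereal (f x + q x)"
        if "x \<in> carrier_vec n" for x
        using obj[OF kK that] t
        by (simp add: forward_objective_def Let_def q_def B_def c_def i_def r_def)
      have min: "f x + q x \<le> f x' + q x'"
        if x': "x' \<in> carrier_vec n" "0\<^sub>v n \<le> x'" "A *\<^sub>v x' = A *\<^sub>v x" for x'
      proof -
        have "x' \<in> feasible P t R w" using x' x(3) by (simp add: feas)
        then have "\<not> forward_objective P Q \<rho> sel \<xi> g (Suc k) t w x' < forward_objective P Q \<rho> sel \<xi> g (Suc k) t w x"
          using decision_arg_min[OF \<omega>(1) t', of "Suc k"] \<omega>(2) unfolding is_arg_min_def x_def R_def by blast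
        then show ?thesis using fobj x(1) x'(1) by simp
      qed
      have best: "f x \<le> f y" if y: "y \<in> feasible P t R w" for y
      proof -
        have y': "y \<in> carrier_vec n" "0\<^sub>v n \<le> y" "R + A *\<^sub>v y = rhs P t w" using y by (auto simp: feas)
        have "A *\<^sub>v x = A *\<^sub>v y"
        proof (rule eq_vecI)
          fix j assume "j < dim_vec (A *\<^sub>v y)"
          then have j: "j < m" using A by simp
          have "(R + A *\<^sub>v x) $ j = (R + A *\<^sub>v y) $ j" using x(3) y'(3) by simp
          then show "(A *\<^sub>v x) $ j = (A *\<^sub>v y) $ j"
            using j R A by (simp del: index_mult_mat_vec)
        qed simp
        then show ?thesis
          using 1(2)[of x y r "\<rho> (Suc k)" "\<lambda>j. intercept j t i"] x(1,2) y'(1,2) r Bxr \<rho>_nonneg K2[of "Suc k"] k min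
          unfolding f_def q_def by simp
      qed
      have "stage_value P (V k t) t R w = (INF y\<in>feasible P t R w. ereal (f y))"
        unfolding stage_value_def using obj[OF kK] by (intro INF_cong) (auto simp: feas B_def c_def i_def)
      also have "\<dots> = ereal (f x)"
        using xf best by (intro antisym INF_greatest INF_lower2[of x]) auto
      finally show ?thesis using obj[OF kK x(1)] by (simp add: x_def R_def)
    qed
    then show ?case unfolding B_def c_def i_def by blast
  qed
qed

lemma forward_decisions_exact:
  "\<exists>K. \<forall>k\<ge>K. \<forall>t<horizon P. \<forall>\<omega>\<in>scenarios P.
    stage_value P (V k t) t (incoming P \<omega> (X (Suc k) \<omega>) t) (\<omega> t) =
    ereal (cost P t (\<omega> t) \<bullet> X (Suc k) \<omega> t) + V k t (matB P t (\<omega> t) *\<^sub>v X (Suc k) \<omega> t) (info P t (\<omega> t))"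
proof -
  obtain K where K: "\<And>t w k \<omega>. t < horizon P \<Longrightarrow> w \<in> realizations P t \<Longrightarrow> K t w \<le> k \<Longrightarrow> \<omega> \<in> scenarios P \<Longrightarrow>
    \<omega> t = w \<Longrightarrow> stage_value P (V k t) t (incoming P \<omega> (X (Suc k) \<omega>) t) w =
    ereal (cost P t w \<bullet> X (Suc k) \<omega> t) + V k t (matB P t w *\<^sub>v X (Suc k) \<omega> t) (info P t w)"
    using forward_decisions_exact_stage by metis
  define S where "S = (SIGMA t:{..<horizon P}. realizations P t)"
  have "finite S" unfolding S_def by (intro finite_SigmaI finite_realizations) auto
  then have le: "K t w \<le> Max ((\<lambda>(t, w). K t w) ` S)" if "t < horizon P" "w \<in> realizations P t" for t w
    using that by (intro Max_ge) (auto simp: S_def)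
  show ?thesis
  proof (intro exI allI impI ballI)
    fix k t \<omega>
    assume k: "Max ((\<lambda>(t, w). K t w) ` S) \<le> k" and t: "t < horizon P" and \<omega>: "\<omega> \<in> scenarios P"
    have w: "\<omega> t \<in> realizations P t" using realization[OF \<omega>] t by simp
    show "stage_value P (V k t) t (incoming P \<omega> (X (Suc k) \<omega>) t) (\<omega> t) =
      ereal (cost P t (\<omega> t) \<bullet> X (Suc k) \<omega> t) + V k t (matB P t (\<omega> t) *\<^sub>v X (Suc k) \<omega> t) (info P t (\<omega> t))"
      using K[OF t w order_trans[OF le[OF t w] k] \<omega> refl] .
  qed
qed

section \<open>Optimality in the absence of gaps\<close>

lemma scenario_extension:
  assumes \<omega>: "\<omega> \<in> scenarios P" and t: "t < horizon P" and w: "w \<in> realizations P (Suc t)"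
    and p: "trans_prob P t (info P t (\<omega> t)) w \<noteq> 0"
  obtains \<omega>' where "\<omega>' \<in> scenarios P" "\<omega>' (Suc t) = w" "\<And>s. s \<le> t \<Longrightarrow> \<omega>' s = \<omega> s"
proof -
  let ?E = "{\<omega>'. \<omega>' (Suc t) = w \<and> (\<forall>s\<le>t. \<omega>' s = \<omega> s)}"
  \<comment> \<open>By the Markov property the transition probability is also the conditional
    probability given the whole prefix of \<open>\<omega>\<close>. A nonzero quotient has a nonzero
    numerator, so some scenario of positive probability follows the prefix and continues with
    \<open>w\<close>.\<close>
  have "\<P>(\<omega>' in measure_pmf (law P). \<omega>' (Suc t) = w \<bar> (\<forall>s\<le>t. \<omega>' s = \<omega> s)) \<noteq> 0"
    using markov assms unfolding markov_process_def by auto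
  then have "measure (measure_pmf (law P)) ?E \<noteq> 0"
    by (auto simp: cond_prob_def)
  then have "set_pmf (law P) \<inter> ?E \<noteq> {}"
    by (simp add: measure_pmf_zero_iff)
  then obtain \<omega>' where "\<omega>' \<in> set_pmf (law P)" "\<omega>' \<in> ?E" by blast
  moreover have "set_pmf (law P) \<subseteq> scenarios P" using data by (simp add: mslp_data_def)
  ultimately show thesis using that by blast
qed

text \<open>Nonanticipativity of the selection rule. Scenarios with a common prefix reach the same
  state, which lets the backward induction below pass from a scenario to its branches.\<close>

lemma decision_cong: "(\<And>s. s \<le> t \<Longrightarrow> \<omega>' s = \<omega> s) \<Longrightarrow> X k \<omega>' t = X k \<omega> t"
  unfolding decision_def by (metis atLeastAtMost_iff restrict_ext)

text \<open>Backward induction over all scenarios at once. Exactness replaces the minimum for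
  \<open>V k\<close> by the value at the decision taken; without a gap that value dominates the one
  formed with the Bellman update, in which the induction hypothesis puts \<open>Vstar\<close> for
  \<open>V k\<close>. The opposite inequality is \<open>V_le_Vstar\<close>.\<close>

lemma approximations_optimal_if_no_gap:
  assumes exact: "\<And>t \<omega>. t < horizon P \<Longrightarrow> \<omega> \<in> scenarios P \<Longrightarrow>
    stage_value P (V k t) t (incoming P \<omega> (X (Suc k) \<omega>) t) (\<omega> t) =
    ereal (cost P t (\<omega> t) \<bullet> X (Suc k) \<omega> t) + V k t (matB P t (\<omega> t) *\<^sub>v X (Suc k) \<omega> t) (info P t (\<omega> t))"
    and no_gap: "\<And>\<omega>. \<omega> \<in> scenarios P \<Longrightarrow> \<not> bellman_gap P sel \<xi> g k \<omega>"
  shows "approximations_optimal P sel \<xi> g k"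
proof -
  have "stage_value P (V k t) t (incoming P \<omega> (X (Suc k) \<omega>) t) (\<omega> t) =
      stage_value P (Vstar P t) t (incoming P \<omega> (X (Suc k) \<omega>) t) (\<omega> t)"
    if "\<omega> \<in> scenarios P" "t \<le> horizon P" for \<omega> t
    using that
  proof (induction "horizon P - t" arbitrary: t \<omega>)
    case 0
    then show ?case by (simp add: V_horizon)
  next
    case (Suc n)
    then have t: "t < horizon P" by simp
    have w: "\<omega> t \<in> realizations P t" using realization Suc.prems by blast
    let ?x = "X (Suc k) \<omega> t" and ?i = "info P t (\<omega> t)"
    let ?R = "matB P t (\<omega> t) *\<^sub>v ?x"
    have next_eq: "stage_value P (V k (Suc t)) (Suc t) ?R w = stage_value P (Vstar P (Suc t)) (Suc t) ?R w"
      if ext: "w \<in> realizations P (Suc t)" "trans_prob P t ?i w \<noteq> 0" for w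
    proof -
      obtain \<omega>' where \<omega>': "\<omega>' \<in> scenarios P" "\<omega>' (Suc t) = w" "\<And>s. s \<le> t \<Longrightarrow> \<omega>' s = \<omega> s"
        using scenario_extension[OF Suc.prems(1) t ext] by blast
      have "incoming P \<omega>' (X (Suc k) \<omega>') (Suc t) = ?R"
        using \<omega>'(3) decision_cong[of t \<omega>' \<omega> "Suc k"] by (simp add: incoming_def)
      then show ?thesis
        using Suc.hyps(1)[of "Suc t" \<omega>'] Suc.hyps(2) \<omega>'(1,2) t by simp
    qed
    have Vstar: "Vstar P t ?R ?i = expected_stage_value P (Vstar P (Suc t)) t ?R ?i"
      using t by (subst Vstar.simps) simp
    have "expected_stage_value P (V k (Suc t)) t ?R ?i = Vstar P t ?R ?i"
      unfolding Vstar expected_stage_value_def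
    proof (intro sum.cong refl)
      \<comment> \<open>The induction hypothesis says nothing about a realization of transition
        probability zero, but its term vanishes whatever its stage value, since 0 times infinity is
        0 for extended reals.\<close>
      fix w assume "w \<in> realizations P (Suc t)"
      then show "ereal (trans_prob P t ?i w) * stage_value P (V k (Suc t)) (Suc t) ?R w =
          ereal (trans_prob P t ?i w) * stage_value P (Vstar P (Suc t)) (Suc t) ?R w"
        using next_eq by (cases "trans_prob P t ?i w = 0") (auto simp: zero_ereal_def[symmetric])
    qed
    moreover have "expected_stage_value P (V k (Suc t)) t ?R ?i \<le> V k t ?R ?i"
      using no_gap[OF Suc.prems(1)] t unfolding bellman_gap_def Let_def by (meson not_less)
    ultimately have "ereal (cost P t (\<omega> t) \<bullet> ?x) + Vstar P t ?R ?i \<le> 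
        stage_value P (V k t) t (incoming P \<omega> (X (Suc k) \<omega>) t) (\<omega> t)"
      unfolding exact[OF t Suc.prems(1)] by (intro add_left_mono) simp
    then have "stage_value P (Vstar P t) t (incoming P \<omega> (X (Suc k) \<omega>) t) (\<omega> t) \<le>
        stage_value P (V k t) t (incoming P \<omega> (X (Suc k) \<omega>) t) (\<omega> t)"
      unfolding stage_value_def[of P "Vstar P t"]
      by (rule INF_lower2[OF decision_feasible[OF Suc.prems]])
    moreover have "stage_value P (V k t) t (incoming P \<omega> (X (Suc k) \<omega>) t) (\<omega> t) \<le>
        stage_value P (Vstar P t) t (incoming P \<omega> (X (Suc k) \<omega>) t) (\<omega> t)"
      using Suc.prems w by (intro stage_value_mono V_le_Vstar post_state)
    ultimately show ?case by (rule antisym[rotated])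
  qed
  then show ?thesis unfolding approximations_optimal_def Let_def by blast
qed

lemma eventually_optimal_or_gap:
  "\<exists>K. \<forall>k\<ge>K. approximations_optimal P sel \<xi> g k \<or> (\<exists>\<omega>\<in>scenarios P. bellman_gap P sel \<xi> g k \<omega>)"
  using forward_decisions_exact approximations_optimal_if_no_gap by meson

end

subsection \<open>Sampling\<close>

text \<open>The first hits after time \<open>N\<close> are disjoint events, so the probabilities of the trials preceding a
  first hit are summable and Borel-Cantelli applies.\<close>

lemma (in prob_space) AE_finite_trials_if_finite_hits:
  fixes E H :: "nat \<Rightarrow> 'a set" and p :: real
  assumes p: "0 < p"
    and meas: "\<And>n. E n \<in> events" "\<And>n. H n \<in> events"
    and hit: "\<And>N n. p * prob (E n - (\<Union>j\<in>{N..<n}. E j \<inter> H j)) \<le>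
      prob ((E n - (\<Union>j\<in>{N..<n}. E j \<inter> H j)) \<inter> H n)"
  shows "AE x in M. finite {n. x \<in> E n \<inter> H n} \<longrightarrow> finite {n. x \<in> E n}"
proof -
  \<comment> \<open>Trials at time \<open>n\<close> not preceded by a hit since \<open>N\<close>;
    intersecting with \<open>H n\<close> gives the first hits.\<close>
  define U where "U N n = E n - (\<Union>j\<in>{N..<n}. E j \<inter> H j)" for N n
  have U: "U N n \<in> events" for N n unfolding U_def using meas by auto
  have "AE x in M. \<forall>\<^sub>F n in sequentially. x \<in> space M - U N n" for N
  proof (rule borel_cantelli_AE1)
    have disj: "disjoint_family_on (\<lambda>n. U N n \<inter> H n) {N..}"
      unfolding disjoint_family_on_def U_def
    proof (intro ballI impI)
      fix m n assume "m \<in> {N..}" "n \<in> {N..}" "m \<noteq> n"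
      then have "m \<in> {N..<n} \<or> n \<in> {N..<m}" by auto
      then show "(E m - (\<Union>j\<in>{N..<m}. E j \<inter> H j)) \<inter> H m \<inter> ((E n - (\<Union>j\<in>{N..<n}. E j \<inter> H j)) \<inter> H n) = {}"
        by blast
    qed
    have bound: "(\<Sum>n\<in>{N..<m}. prob (U N n)) \<le> 1 / p" for m
    proof -
      have "p * (\<Sum>n\<in>{N..<m}. prob (U N n)) \<le> (\<Sum>n\<in>{N..<m}. prob (U N n \<inter> H n))"
        unfolding sum_distrib_left U_def by (intro sum_mono hit)
      also have "\<dots> = prob (\<Union>n\<in>{N..<m}. U N n \<inter> H n)"
        using U meas
        by (intro finite_measure_finite_Union[symmetric] disjoint_family_on_mono[OF _ disj]) auto
      also have "\<dots> \<le> 1" by simp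
      finally show ?thesis using p by (simp add: pos_le_divide_eq mult.commute)
    qed
    have "(\<Sum>n<m. prob (U N (n + N))) \<le> 1 / p" for m
      using sum.shift_bounds_nat_ivl[of "\<lambda>n. prob (U N n)" 0 N m] bound[of "m + N"]
      by (simp add: lessThan_atLeast0)
    then have "summable (\<lambda>n. prob (U N (n + N)))"
      by (intro summableI_nonneg_bounded) auto
    then show "summable (\<lambda>n. prob (U N n))" by (subst (asm) summable_iff_shift)
  qed (use U in \<open>auto simp: emeasure_eq_measure\<close>)
  then have "AE x in M. \<forall>N. \<forall>\<^sub>F n in sequentially. x \<in> space M - U N n"
    by (simp add: AE_all_countable)
  then show ?thesis
  proof eventually_elim
    case (elim x)
    show ?case
    proof
      assume "finite {n. x \<in> E n \<inter> H n}"
      then obtain N where N: "\<And>n. x \<in> E n \<inter> H n \<Longrightarrow> n < N"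
        by (metis (mono_tags, lifting) finite_nat_set_iff_bounded mem_Collect_eq)
      obtain K where K: "\<And>n. K \<le> n \<Longrightarrow> x \<notin> U N n"
        using elim unfolding eventually_sequentially by blast
      \<comment> \<open>As all hits at \<open>x\<close> precede \<open>N\<close>, nothing is removed
        from \<open>E n\<close> at \<open>x\<close>, and the end of \<open>U N n\<close> is the end
        of the trials.\<close>
      have "x \<notin> E n" if "K \<le> n" for n
        using K[OF that] N unfolding U_def by fastforce
      then have "{n. x \<in> E n} \<subseteq> {..<K}" by (auto simp: not_le[symmetric])
      then show "finite {n. x \<in> E n}" by (rule finite_subset) simp
    qed
  qed
qed

text \<open>A union of fibres of \<open>h\<close> is a preimage, and \<open>count_space UNIV\<close>
  makes every set of values measurable. Measurability of an event thus reduces to its being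
  determined by the history, with no regularity asked of the selection rule.\<close>

lemma saturated_in_vimage_algebra:
  assumes "S \<subseteq> \<Omega>" "\<And>z z'. z \<in> S \<Longrightarrow> z' \<in> \<Omega> \<Longrightarrow> h z = h z' \<Longrightarrow> z' \<in> S"
  shows "S \<in> sets (vimage_algebra \<Omega> h (count_space UNIV))"
proof -
  have "S = h -` (h ` S) \<inter> \<Omega>" using assms by auto
  moreover have "h -` (h ` S) \<inter> \<Omega> \<in> sets (vimage_algebra \<Omega> h (count_space UNIV))"
    by (intro in_vimage_algebra) simp
  ultimately show ?thesis by simp
qed

section \<open>Dependence of the gaps on the past\<close>

lemma history_eq_iff: "history \<xi> g n = history \<xi>' g' n \<longleftrightarrow> (\<forall>j<n. \<xi> j = \<xi>' j \<and> g j = g' j)"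
  by (auto simp: history_def)

lemma Vbar_cong:
  assumes "\<And>j. j \<le> k \<Longrightarrow> Rs j = Rs' j" "\<And>j. j \<le> k \<Longrightarrow> g j = g' j"
  shows "Vbar P Rs g k t = Vbar P Rs' g' k t"
  using assms
proof (induction "horizon P - t" arbitrary: t k)
  case 0
  then show ?case by (subst (1 2) Vbar.simps) simp
next
  case (Suc n)
  then have t: "t < horizon P" and n: "n = horizon P - Suc t" by simp_all
  have next_eq: "Vbar P Rs g j (Suc t) = Vbar P Rs' g' j (Suc t)" if "j \<le> k" for j
    using Suc.hyps(1)[OF n] Suc.prems that by simp
  have "j \<le> k \<Longrightarrow> Vbar P Rs g j t = Vbar P Rs' g' j t" for j
  proof (induction j)
    case 0
    show ?case
      using t next_eq[OF 0] Suc.prems[OF 0]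
      by (subst Vbar.simps, subst (2) Vbar.simps) simp
  next
    case (Suc j)
    then show ?case
      using t next_eq[OF Suc.prems] \<open>\<And>j. j \<le> k \<Longrightarrow> Rs j = Rs' j\<close>[OF Suc.prems]
        \<open>\<And>j. j \<le> k \<Longrightarrow> g j = g' j\<close>[OF Suc.prems]
      by (subst Vbar.simps, subst (3) Vbar.simps) simp
  qed
  then show ?case by simp
qed

text \<open>The history of length \<open>Suc k\<close> covers iterations 0 to \<open>k\<close>.
  These fix the approximations and, through the selection rule, also the decisions that iteration
  \<open>k + 1\<close> would take along any scenario.\<close>

lemma bellman_gap_cong:
  assumes "history \<xi> g (Suc k) = history \<xi>' g' (Suc k)"
  shows "bellman_gap P sel \<xi> g k \<omega> \<longleftrightarrow> bellman_gap P sel \<xi>' g' k \<omega>"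
proof -
  have eq: "\<xi> j = \<xi>' j" "g j = g' j" "history \<xi> g j = history \<xi>' g' j" if "j \<le> k" for j
    using assms that unfolding history_eq_iff by auto
  have "trial P sel \<xi> g j = trial P sel \<xi>' g' j" if "j \<le> k" for j
    using eq[OF that] by (intro ext) (simp add: trial_def decision_def)
  then have "approx P sel \<xi> g k t = approx P sel \<xi>' g' k t" for t
    unfolding approx_def using eq by (intro Vbar_cong) auto
  moreover have "decision sel \<xi> g (Suc k) \<omega> t = decision sel \<xi>' g' (Suc k) \<omega> t" for t
    unfolding decision_def assms ..
  ultimately show ?thesis unfolding bellman_gap_def by simp
qed

theorem theorem7:
  fixes P :: "('w, 'i) mslp"
    and Q :: "nat \<Rightarrow> real mat"
    and \<rho> :: "nat \<Rightarrow> real"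
    and M :: "'z measure"
    and \<xi> :: "'z \<Rightarrow> nat \<Rightarrow> nat \<Rightarrow> 'w"
    and g :: "'z \<Rightarrow> nat \<Rightarrow> nat \<Rightarrow> 'w \<Rightarrow> real vec"
    and sel :: "'w selection"
  assumes "mslp_data P"
    and "markov_process P"
    and "relatively_complete_recourse P"
    and "\<And>t. t \<le> horizon P \<Longrightarrow> psd (nrow P (Suc t)) (Q t)"
    and "independent_sampling P M \<xi> g"
    and "\<And>z. z \<in> space M \<Longrightarrow> forward_passes P Q \<rho> sel (\<xi> z) (g z)"
    and "\<And>z. z \<in> space M \<Longrightarrow> backward_passes P sel (\<xi> z) (g z)"
    and "\<And>z k i R. z \<in> space M \<Longrightarrow> i \<in> info_states P (horizon P) \<Longrightarrow>
           R \<in> carrier_vec (nrow P (Suc (horizon P))) \<Longrightarrow>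
           approx P sel (\<xi> z) (g z) k (horizon P) R i = Vstar P (horizon P) R i"
    and "\<And>z. z \<in> space M \<Longrightarrow> dual_basic_solutions_used P sel (\<xi> z) (g z)"
    and "\<And>\<omega>. \<omega> \<in> scenarios P \<Longrightarrow> 0 < pmf (law P) \<omega>"
    and "\<And>k. 0 \<le> \<rho> k"
    and "\<rho> \<longlonglongrightarrow> 0"
    and "bounded_feasible_sets P"
  shows "AE z in M. \<exists>k0. \<forall>k\<ge>k0. approximations_optimal P sel (\<xi> z) (g z) k"
proof -
  interpret prob_space M using assms(5) by (simp add: independent_sampling_def)
  have path: "regularized_path P Q \<rho> sel (\<xi> z) (g z)" if "z \<in> space M" for z
    using assms that by unfold_locales auto
  have fin: "finite (scenarios P)"
  proof (rule finite_subset)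
    show "scenarios P \<subseteq> (\<Pi>\<^sub>E t\<in>{0..horizon P}. realizations P t)"
      using assms(1) by (simp add: mslp_data_def)
    show "finite (\<Pi>\<^sub>E t\<in>{0..horizon P}. realizations P t)"
      using assms(1) by (intro finite_PiE) (auto simp: mslp_data_def)
  qed
  define hist where "hist n z = history (\<xi> z) (g z) n" for n z
  have indep: "indep_set (sets (vimage_algebra (space M) (hist n) (count_space UNIV)))
      (sets (vimage_algebra (space M) (\<lambda>z. \<xi> z n) (count_space UNIV)))"
    and law: "distr M (count_space UNIV) (\<lambda>z. \<xi> z n) = measure_pmf (law P)" for n
    using assms(5) unfolding independent_sampling_def hist_def by auto
  let ?gap = "\<lambda>n \<omega> z. bellman_gap P sel (\<xi> z) (g z) n \<omega>"
  have "AE z in M. finite {n. ?gap n \<omega> z \<and> \<xi> z (Suc n) = \<omega>} \<longrightarrow> finite {n. ?gap n \<omega> z}"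
    if \<omega>: "\<omega> \<in> scenarios P" for \<omega>
  proof -
    \<comment> \<open>For a fixed scenario, a trial is a gap along it and a hit is its being drawn
      as the very next sample.\<close>
    define E where "E n = {z \<in> space M. ?gap n \<omega> z}" for n
    define H where "H n = {z \<in> space M. \<xi> z (Suc n) = \<omega>}" for n
    have H: "H n \<in> sets (vimage_algebra (space M) (\<lambda>z. \<xi> z (Suc n)) (count_space UNIV))" for n
      by (rule saturated_in_vimage_algebra) (auto simp: H_def)
    have prob_H: "prob (H n) = pmf (law P) \<omega>" for n
    proof -
      have "(\<lambda>z. \<xi> z (Suc n)) \<in> measurable M (count_space UNIV)"
      proof (rule measurableI)
        fix A :: "(nat \<Rightarrow> 'w) set"
        show "(\<lambda>z. \<xi> z (Suc n)) -` A \<inter> space M \<in> events"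
          by (rule indep_setD_ev2[OF indep[of "Suc n"], THEN subsetD], rule in_vimage_algebra) simp
      qed simp
      then have "measure (distr M (count_space UNIV) (\<lambda>z. \<xi> z (Suc n))) {\<omega>} =
          prob ((\<lambda>z. \<xi> z (Suc n)) -` {\<omega>} \<inter> space M)"
        by (rule measure_distr) simp
      moreover have "(\<lambda>z. \<xi> z (Suc n)) -` {\<omega>} \<inter> space M = H n" by (auto simp: H_def)
      ultimately show ?thesis unfolding law by (simp add: pmf.rep_eq)
    qed
    \<comment> \<open>\<open>H j\<close> concerns sample \<open>Suc j\<close>. As
      \<open>j < n\<close>, this sample is among those recorded in \<open>hist (Suc n)\<close>, so
      the removed hits are past events; the hit \<open>H n\<close> itself concerns the next
      sample.\<close>
    have U: "E n - (\<Union>j\<in>{N..<n}. E j \<inter> H j) \<in> sets (vimage_algebra (space M) (hist (Suc n)) (count_space UNIV))" for N n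
    proof (rule saturated_in_vimage_algebra)
      fix z z' assume z: "z \<in> E n - (\<Union>j\<in>{N..<n}. E j \<inter> H j)" "z' \<in> space M" "hist (Suc n) z = hist (Suc n) z'"
      have zM: "z \<in> space M" using z(1) by (simp add: E_def)
      have "history (\<xi> z) (g z) (Suc j) = history (\<xi> z') (g z') (Suc j)" if "j \<le> n" for j
        using z(3) that unfolding hist_def history_eq_iff by auto
      then have "z \<in> E j \<longleftrightarrow> z' \<in> E j" if "j \<le> n" for j
        using bellman_gap_cong zM z(2) that unfolding E_def by blast
      moreover have "z \<in> H j \<longleftrightarrow> z' \<in> H j" if "j < n" for j
        using z(2,3) zM that unfolding hist_def history_eq_iff H_def by auto
      ultimately show "z' \<in> E n - (\<Union>j\<in>{N..<n}. E j \<inter> H j)" using z(1) by auto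
    qed (auto simp: E_def)
    have "AE z in M. finite {n. z \<in> E n \<inter> H n} \<longrightarrow> finite {n. z \<in> E n}"
    proof (rule AE_finite_trials_if_finite_hits)
      show "0 < pmf (law P) \<omega>" using assms(10) \<omega> .
      show "E n \<in> events" for n
        using U[of n n] indep_setD_ev1[OF indep[of "Suc n"]] by auto
      show "H n \<in> events" for n
        using H indep_setD_ev2[OF indep[of "Suc n"]] by auto
      show "pmf (law P) \<omega> * prob (E n - (\<Union>j\<in>{N..<n}. E j \<inter> H j)) \<le>
          prob ((E n - (\<Union>j\<in>{N..<n}. E j \<inter> H j)) \<inter> H n)" for N n
        using indep_setD[OF indep U H] prob_H by (simp add: mult.commute)
    qed
    then show ?thesis
    proof (rule AE_mp, intro AE_I2 impI)
      fix z assume "z \<in> space M" "finite {n. z \<in> E n \<inter> H n} \<longrightarrow> finite {n. z \<in> E n}"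
        "finite {n. ?gap n \<omega> z \<and> \<xi> z (Suc n) = \<omega>}"
      then show "finite {n. ?gap n \<omega> z}" by (simp add: E_def H_def)
    qed
  qed
  then have "AE z in M. \<forall>\<omega>\<in>scenarios P.
      finite {n. ?gap n \<omega> z \<and> \<xi> z (Suc n) = \<omega>} \<longrightarrow> finite {n. ?gap n \<omega> z}"
    using fin by (intro AE_finite_allI)
  then show ?thesis
  proof (rule AE_mp, intro AE_I2 impI)
    fix z assume z: "z \<in> space M" and
      gaps: "\<forall>\<omega>\<in>scenarios P. finite {n. ?gap n \<omega> z \<and> \<xi> z (Suc n) = \<omega>} \<longrightarrow> finite {n. ?gap n \<omega> z}"
    interpret regularized_path P Q \<rho> sel "\<xi> z" "g z" using path[OF z] .
    have "finite {n. ?gap n \<omega> z}" if "\<omega> \<in> scenarios P" for \<omega>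
    proof -
      \<comment> \<open>Each hit is a gap along the sampled scenario, and on every single path there
        are only finitely many of these.\<close>
      have "finite {n. ?gap n \<omega> z \<and> \<xi> z (Suc n) = \<omega>}"
        by (rule finite_subset[OF _ finite_sampled_bellman_gaps]) auto
      then show ?thesis using gaps that by blast
    qed
    then have "finite (\<Union>\<omega>\<in>scenarios P. {n. ?gap n \<omega> z})" using fin by blast
    then obtain N where N: "\<And>n. n \<in> (\<Union>\<omega>\<in>scenarios P. {n. ?gap n \<omega> z}) \<Longrightarrow> n < N"
      unfolding finite_nat_set_iff_bounded by blast
    obtain K where K: "\<And>k. K \<le> k \<Longrightarrow> approximations_optimal P sel (\<xi> z) (g z) k \<or> (\<exists>\<omega>\<in>scenarios P. ?gap k \<omega> z)"
      using eventually_optimal_or_gap by blast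
    have "approximations_optimal P sel (\<xi> z) (g z) k" if "max K N \<le> k" for k
      using K[of k] N[of k] that by fastforce
    then show "\<exists>k0. \<forall>k\<ge>k0. approximations_optimal P sel (\<xi> z) (g z) k" by blast
  qed
qed

end
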